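(* Let $d\ge1$, let $\Lambda\subset(0,+\infty)^d$ be $\sigma$-compact, and let $X=\ell_p(\mathbb N)$ with $p\in[1,+\infty)$, or $X=c_0(\mathbb N)$. The following assertions are equivalent: (a) $(e^{\lambda(1)}B\times\cdots\times e^{\lambda(d)}B)_{\lambda\in\Lambda}$ admits a common hypercyclic vector in $X^d$. (b) For all $\tau>0$, all integers $N\ge1$ and all compact $K\subset\Lambda$, there exist finitely many integers $n_1,\dots,n_q$ with $n_1\ge N$ and $n_{k+1}\ge n_k+N$ for $k=1,\dots,q-1$, and elements $\lambda_1,\dots,\lambda_q\in(0,+\infty)^d$, such that (i) $K\subset\bigcup_{k=1}^q\prod_{i=1}^d\left[\lambda_k(i)-\frac{\tau}{n_k},\lambda_k(i)\right]$; (ii) for all $k=1,\dots,q-1$ and all $i=1,\dots,d$, $$\lambda_{k+1}(i)n_{k+1}-\lambda_k(i)n_k\ge N.$$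
   Context: $B$ is the (unweighted) backward shift on $X$: $B(x_0,x_1,x_2,\dots)=(x_1,x_2,\dots)$. Products of operators act coordinatewise on $X^d$; $\lambda=(\lambda(1),\dots,\lambda(d))$. A common hypercyclic vector for a family of operators is a vector $x$ whose orbit $\{T^nx:n\ge0\}$ is dense for every $T$ in the family. *)

theory Defs
  imports "HOL-Analysis.Analysis"
begin

section \<open>The sequence spaces \<open>\<ell>\<^sub>p(\<nat>)\<close> and \<open>c\<^sub>0(\<nat>)\<close>\<close>

text \<open>
  Since \<open>p\<close> is a real parameter, the spaces are carrier sets of sequences, topologised by
  the metric of their norm. The norm formulas are only meaningful on these carriers.

  The scalar field of the sequence spaces is later taken of sort
  \<open>{real_normed_field, euclidean_space}\<close>: up to isometric isomorphism, the finite-dimensional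
  real normed fields are exactly \<open>\<real>\<close> and \<open>\<complex>\<close>, so this covers both choices of scalars.
\<close>

definition lp_seqs :: "real \<Rightarrow> (nat \<Rightarrow> 'a::real_normed_vector) set" where
  "lp_seqs p = {x. summable (\<lambda>n. norm (x n) powr p)}"

definition lp_norm :: "real \<Rightarrow> (nat \<Rightarrow> 'a::real_normed_vector) \<Rightarrow> real" where
  "lp_norm p x = (\<Sum>n. norm (x n) powr p) powr (1 / p)"

definition c0_seqs :: "(nat \<Rightarrow> 'a::real_normed_vector) set" where
  "c0_seqs = {x. x \<longlonglongrightarrow> 0}"

text \<open>
  A metric in the sense of the library has to be non-negative and symmetric also outside its
  carrier, where the supremum may be an unspecified value; hence the case distinction.
\<close>

definition c0_dist :: "(nat \<Rightarrow> 'a::real_normed_vector) \<Rightarrow> (nat \<Rightarrow> 'a) \<Rightarrow> real" where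
  "c0_dist x y = (if x \<in> c0_seqs \<and> y \<in> c0_seqs then SUP n. norm (x n - y n) else 0)"

definition lp_space :: "real \<Rightarrow> (nat \<Rightarrow> 'a::real_normed_vector) topology" where
  "lp_space p = Metric_space.mtopology (lp_seqs p) (\<lambda>x y. lp_norm p (\<lambda>n. x n - y n))"

definition c0_space :: "(nat \<Rightarrow> 'a::real_normed_vector) topology" where
  "c0_space = Metric_space.mtopology c0_seqs c0_dist"

text \<open>
  The library proves that \<^const>\<open>Metric_space.mtopology\<close> is the metric topology only for an
  actual metric, so we check that both distances are metrics.
\<close>

lemma powr_convex_comb:
  fixes p s t a b :: real
  assumes "1 \<le> p" "0 \<le> s" "0 \<le> t" "0 \<le> a" "0 \<le> b" "a + b = 1"
  shows "(a * s + b * t) powr p \<le> a * s powr p + b * t powr p"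
proof -
  have zero: "(c * r) powr p \<le> c * r powr p" if "0 \<le> c" "c \<le> 1" "0 \<le> r" for c r :: real
  proof -
    have "c powr p \<le> c"
      using powr_mono'[of 1 p c] that assms(1) by (cases "c = 0") auto
    then show ?thesis
      using that by (simp add: powr_mult mult_right_mono)
  qed
  consider "s = 0" | "t = 0" | "0 < s" "0 < t" using assms by linarith
  then show ?thesis
  proof cases
    case 1
    then show ?thesis using zero[of b t] assms by simp
  next
    case 2
    then show ?thesis using zero[of a s] assms by simp
  next
    case 3
    then show ?thesis
      using convex_onD[OF powr_convex[OF assms(1)], of b s t] assms
      by (simp add: algebra_simps flip: eq_diff_eq)
  qed
qed

lemma lp_norm_ge_0: "0 \<le> lp_norm p x"
  by (simp add: lp_norm_def)

lemma lp_norm_powr: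
  assumes "1 \<le> p" "x \<in> lp_seqs p"
  shows "lp_norm p x powr p = (\<Sum>n. norm (x n) powr p)"
  using assms by (simp add: lp_norm_def lp_seqs_def powr_powr suminf_nonneg)

lemma lp_norm_eq_0_iff:
  assumes "1 \<le> p" "x \<in> lp_seqs p"
  shows "lp_norm p x = 0 \<longleftrightarrow> (\<forall>n. x n = 0)"
  using assms by (auto simp: lp_norm_def lp_seqs_def suminf_eq_zero_iff)

lemma lp_norm_triangle:
  assumes p: "1 \<le> p" and x: "x \<in> lp_seqs p" and y: "y \<in> lp_seqs p"
  shows "(\<lambda>n. x n + y n) \<in> lp_seqs p \<and>
         lp_norm p (\<lambda>n. x n + y n) \<le> lp_norm p x + lp_norm p y"
proof (cases "lp_norm p x = 0 \<or> lp_norm p y = 0")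
  case True
  then show ?thesis
  proof
    assume "lp_norm p x = 0"
    then have "(\<lambda>n. x n + y n) = y"
      using lp_norm_eq_0_iff[OF p x] by auto
    then show ?thesis using y lp_norm_ge_0[of p x] by simp
  next
    assume "lp_norm p y = 0"
    then have "(\<lambda>n. x n + y n) = x"
      using lp_norm_eq_0_iff[OF p y] by auto
    then show ?thesis using x lp_norm_ge_0[of p y] by simp
  qed
next
  case False
  define A B C where "A = lp_norm p x" and "B = lp_norm p y" and "C = A + B"
  have pos: "A > 0" "B > 0" "C > 0"
    using False lp_norm_ge_0[of p x] lp_norm_ge_0[of p y] by (auto simp: A_def B_def C_def)
  define f where "f n = A / C * (norm (x n) / A) powr p + B / C * (norm (y n) / B) powr p" for n
  define g where "g n = norm (x n + y n) powr p" for n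
  have "(norm (x n + y n) / C) powr p \<le> f n" for n
  proof -
    have "norm (x n + y n) / C \<le> (norm (x n) + norm (y n)) / C"
      using pos by (intro divide_right_mono norm_triangle_ineq) auto
    also have "\<dots> = A / C * (norm (x n) / A) + B / C * (norm (y n) / B)"
      using pos by (simp add: field_simps)
    finally have "(norm (x n + y n) / C) powr p
        \<le> (A / C * (norm (x n) / A) + B / C * (norm (y n) / B)) powr p"
      using p pos by (intro powr_mono2) auto
    also have "\<dots> \<le> f n"
      unfolding f_def using p pos by (intro powr_convex_comb) (auto simp: C_def simp flip: add_divide_distrib)
    finally show ?thesis .
  qed
  then have le: "g n \<le> C powr p * f n" for n
    using pos by (simp add: g_def powr_divide field_simps)
  have "(\<lambda>n. norm (x n) powr p) sums A powr p" "(\<lambda>n. norm (y n) powr p) sums B powr p"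
    using x y p by (simp_all add: A_def B_def lp_norm_powr summable_sums lp_seqs_def)
  then have "(\<lambda>n. A / C * (norm (x n) powr p / A powr p) + B / C * (norm (y n) powr p / B powr p)) sums
      (A / C * (A powr p / A powr p) + B / C * (B powr p / B powr p))"
    by (intro sums_add sums_mult sums_divide)
  also have "A / C * (A powr p / A powr p) + B / C * (B powr p / B powr p) = 1"
    using pos by (simp add: C_def flip: add_divide_distrib)
  finally have "f sums 1"
    using pos by (simp add: f_def[abs_def] powr_divide)
  then have Cf: "(\<lambda>n. C powr p * f n) sums (C powr p)"
    using sums_mult[of f 1 "C powr p"] by simp
  have sg: "summable g"
    using Cf le by (intro summable_comparison_test'[of "\<lambda>n. C powr p * f n" 0 g])
      (auto simp: sums_iff g_def)
  have "suminf g \<le> C powr p"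
    using suminf_le[OF le sg] Cf by (simp add: sums_iff)
  then have "suminf g powr (1 / p) \<le> (C powr p) powr (1 / p)"
    using p sg by (intro powr_mono2) (auto simp: g_def intro!: suminf_nonneg)
  also have "\<dots> = C" using p pos by (simp add: powr_powr)
  finally show ?thesis
    using sg by (simp add: lp_norm_def lp_seqs_def g_def[abs_def] A_def B_def C_def)
qed

lemma Metric_space_lp:
  assumes "1 \<le> p"
  shows "Metric_space (lp_seqs p) (\<lambda>x y :: nat \<Rightarrow> 'a::real_normed_vector. lp_norm p (\<lambda>n. x n - y n))"
proof -
  have minus: "(\<lambda>n. x n - y n) \<in> lp_seqs p" if "x \<in> lp_seqs p" "y \<in> lp_seqs p" for x y :: "nat \<Rightarrow> 'a"
    using lp_norm_triangle[OF assms, of x "\<lambda>n. - y n"] that by (simp add: lp_seqs_def)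
  show ?thesis
  proof
    show "lp_norm p (\<lambda>n. x n - y n) = lp_norm p (\<lambda>n. y n - x n)" for x y :: "nat \<Rightarrow> 'a"
      by (simp add: lp_norm_def norm_minus_commute)
    show "lp_norm p (\<lambda>n. x n - z n) \<le> lp_norm p (\<lambda>n. x n - y n) + lp_norm p (\<lambda>n. y n - z n)"
      if "x \<in> lp_seqs p" "y \<in> lp_seqs p" "z \<in> lp_seqs p" for x y z :: "nat \<Rightarrow> 'a"
      using lp_norm_triangle[OF assms minus[of x y] minus[of y z]] that by simp
  qed (auto simp: lp_norm_ge_0 lp_norm_eq_0_iff[OF assms minus])
qed

lemma Metric_space_c0: "Metric_space c0_seqs (c0_dist :: (nat \<Rightarrow> 'a::real_normed_vector) \<Rightarrow> _)"
proof -
  have ub: "norm (x n - y n) \<le> c0_dist x y"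
    if "x \<in> c0_seqs" "y \<in> c0_seqs" for x y :: "nat \<Rightarrow> 'a" and n
  proof -
    have "(\<lambda>n. x n - y n) \<longlonglongrightarrow> 0"
      using tendsto_diff[of x 0 sequentially y 0] that by (simp add: c0_seqs_def)
    then have "Bseq (\<lambda>n. x n - y n)"
      by (meson convergentI convergent_imp_Bseq)
    then have "bdd_above (range (\<lambda>n. norm (x n - y n)))"
      by (auto simp: Bseq_def bdd_above_def)
    then show ?thesis
      using that by (auto simp: c0_dist_def intro: cSUP_upper)
  qed
  have least: "c0_dist x y \<le> c"
    if "x \<in> c0_seqs" "y \<in> c0_seqs" "\<And>n. norm (x n - y n) \<le> c" for x y :: "nat \<Rightarrow> 'a" and c
    using that by (auto simp: c0_dist_def intro: cSUP_least)
  show ?thesis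
  proof
    fix x y z :: "nat \<Rightarrow> 'a"
    show "0 \<le> c0_dist x y"
    proof (cases "x \<in> c0_seqs \<and> y \<in> c0_seqs")
      case True
      then show ?thesis using ub[of x y 0] norm_ge_zero[of "x 0 - y 0"] by linarith
    qed (auto simp: c0_dist_def)
    show "c0_dist x y = c0_dist y x"
      by (auto simp: c0_dist_def norm_minus_commute)
    assume x: "x \<in> c0_seqs" and y: "y \<in> c0_seqs"
    have "x n = y n" if "c0_dist x y = 0" for n
      using ub[OF x y, of n] that by simp
    moreover have "c0_dist x x = 0"
      using x by (simp add: c0_dist_def)
    ultimately show "c0_dist x y = 0 \<longleftrightarrow> x = y" by auto
    assume z: "z \<in> c0_seqs"
    show "c0_dist x z \<le> c0_dist x y + c0_dist y z"
    proof (rule least[OF x z])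
      fix n
      have "norm (x n - z n) \<le> norm (x n - y n) + norm (y n - z n)"
        using norm_triangle_ineq[of "x n - y n" "y n - z n"] by simp
      then show "norm (x n - z n) \<le> c0_dist x y + c0_dist y z"
        using ub[OF x y, of n] ub[OF y z, of n] by linarith
    qed
  qed
qed

section \<open>Shifts and common hypercyclic vectors\<close>

definition backward_shift :: "(nat \<Rightarrow> 'a) \<Rightarrow> nat \<Rightarrow> 'a" where
  "backward_shift x = (\<lambda>n. x (Suc n))"

text \<open>
  The operator \<open>e\<^bsup>l(1)\<^esup> B \<times> \<dots> \<times> e\<^bsup>l(d)\<^esup> B\<close>, with \<open>d = CARD('d)\<close>; an element of \<open>X\<^sup>d\<close> is a
  function \<open>'d \<Rightarrow> nat \<Rightarrow> 'a\<close>.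
\<close>

definition shift_product ::
    "real ^ 'd \<Rightarrow> ('d::finite \<Rightarrow> nat \<Rightarrow> 'a::real_vector) \<Rightarrow> 'd \<Rightarrow> nat \<Rightarrow> 'a" where
  "shift_product l x = (\<lambda>i n. exp (l $ i) *\<^sub>R backward_shift (x i) n)"

definition hypercyclic_vector :: "'b topology \<Rightarrow> ('b \<Rightarrow> 'b) \<Rightarrow> 'b \<Rightarrow> bool" where
  "hypercyclic_vector Y T x \<longleftrightarrow>
     x \<in> topspace Y \<and> Y closure_of (range (\<lambda>n::nat. (T ^^ n) x)) = topspace Y"

definition has_common_hypercyclic_vector :: "'b topology \<Rightarrow> ('b \<Rightarrow> 'b) set \<Rightarrow> bool" where
  "has_common_hypercyclic_vector Y \<T> \<longleftrightarrow>
     (\<exists>x \<in> topspace Y. \<forall>T \<in> \<T>. hypercyclic_vector Y T x)"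

definition sigma_compact :: "'b::topological_space set \<Rightarrow> bool" where
  "sigma_compact S \<longleftrightarrow> (\<exists>C :: nat \<Rightarrow> 'b set. (\<forall>m. compact (C m)) \<and> S = (\<Union>m. C m))"

end

theory Submission
  imports Defs
begin

text \<open>
  If \<open>x\<close> is a common hypercyclic vector, then for each \<open>\<lambda> \<in> K\<close> some iterate \<open>T\<^sup>n x\<close> is close to the
  basis vector with its \<open>1\<close> in position \<open>N\<close> in every coordinate. This determines \<open>n \<lambda>(i)\<close> up to \<open>\<tau>\<close>
  as \<open>- ln \<bar>x\<^sub>i(n + N)\<bar>\<close>, and the smallness of the other entries separates the times used.

  Conversely, put \<open>u = \<Sum>\<^sub>k S\<^sub>k v\<close> where \<open>S\<^sub>k\<close> is the right inverse of the \<open>n\<^sub>k\<close>-th power of the operator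
  with parameter \<open>\<lambda>\<^sub>k\<close>. For \<open>\<lambda>\<close> in the \<open>k\<close>-th box, the \<open>n\<^sub>k\<close>-th power of its operator kills the
  terms before the \<open>k\<close>-th, nearly turns the \<open>k\<close>-th into \<open>v\<close>, and makes the later ones
  geometrically small. Such finitely supported blocks, one for each pair of a compact piece of
  \<open>\<Lambda>\<close> and a target from a countable dense set, are strung together on disjoint ranges of
  indices. All estimates are made in the \<open>\<ell>\<^sub>1\<close> norm, which dominates the other ones, so
  neither Baire's theorem nor completeness of the spaces is needed.
\<close>

section \<open>Sequence spaces between the supremum norm and the l1 norm\<close>

text \<open>Everything the argument uses about \<open>l_p\<close> and \<open>c_0\<close>: the norm
  controls each coordinate, is controlled by the l1 norm, and truncations converge. A bound on all
  partial sums stands for a bound on the l1 norm, so that no summability has to be carried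
  along.\<close>

locale sequence_metric = Metric_space S d
  for S :: "(nat \<Rightarrow> 'a::real_normed_vector) set" and d +
  assumes norm_coord_le: "x \<in> S \<Longrightarrow> y \<in> S \<Longrightarrow> norm (x k - y k) \<le> d x y"
    and mem_of_l1: "(\<And>M. (\<Sum>k<M. norm (x k)) \<le> c) \<Longrightarrow> x \<in> S"
    and dist_le_l1: "x \<in> S \<Longrightarrow> y \<in> S \<Longrightarrow> 0 < c \<Longrightarrow> (\<And>M. (\<Sum>k<M. norm (x k - y k)) \<le> c) \<Longrightarrow> d x y \<le> c"
    and truncation_dense: "x \<in> S \<Longrightarrow> 0 < e \<Longrightarrow> \<exists>m. d x (\<lambda>k. if k < m then x k else 0) < e"

lemma summable_of_sum_norm_le:
  fixes x :: "nat \<Rightarrow> 'a::real_normed_vector"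
  assumes "\<And>M. (\<Sum>k<M. norm (x k)) \<le> c"
  shows "summable (\<lambda>k. norm (x k))"
  by (rule bounded_imp_summable[of _ c]) (simp_all only: norm_ge_zero assms flip: lessThan_Suc_atMost)

text \<open>Each entry has norm at most \<open>c\<close>, so all but one of its \<open>p\<close>
  factors can be replaced by \<open>c\<close>. This is the comparison of the \<open>l_p\<close> norm
  with the l1 norm.\<close>

lemma sum_powr_le_of_sum_norm_le:
  fixes x :: "nat \<Rightarrow> 'a::real_normed_vector"
  assumes p: "1 \<le> p" and c: "0 < c" and le: "\<And>M. (\<Sum>k<M. norm (x k)) \<le> c"
  shows "(\<Sum>k<M. norm (x k) powr p) \<le> c powr p"
proof -
  have each: "norm (x k) \<le> c" for k
    using member_le_sum[of k "{..<Suc k}" "\<lambda>k. norm (x k)"] le[of "Suc k"] by simp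
  have "norm (x k) powr p \<le> norm (x k) * c powr (p - 1)" for k
  proof (cases "x k = 0")
    case False
    then have "norm (x k) powr p = norm (x k) * norm (x k) powr (p - 1)"
      by (simp add: powr_mult_base)
    also have "\<dots> \<le> norm (x k) * c powr (p - 1)"
      using each[of k] p by (intro mult_left_mono powr_mono2) auto
    finally show ?thesis .
  qed simp
  then have "(\<Sum>k<M. norm (x k) powr p) \<le> (\<Sum>k<M. norm (x k)) * c powr (p - 1)"
    by (auto simp: sum_distrib_right intro: sum_mono)
  also have "\<dots> \<le> c * c powr (p - 1)"
    by (intro mult_right_mono le) simp
  also have "\<dots> = c powr p"
    using c by (simp add: powr_mult_base)
  finally show ?thesis .
qed

lemma lp_of_sum_norm_le:
  fixes x :: "nat \<Rightarrow> 'a::real_normed_vector"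
  assumes p: "1 \<le> p" and c: "0 < c" and le: "\<And>M. (\<Sum>k<M. norm (x k)) \<le> c"
  shows "x \<in> lp_seqs p" and "lp_norm p x \<le> c"
proof -
  note b = sum_powr_le_of_sum_norm_le[OF p c le]
  have s: "summable (\<lambda>k. norm (x k) powr p)"
    by (rule bounded_imp_summable[of _ "c powr p"])
      (simp_all only: powr_ge_zero b flip: lessThan_Suc_atMost)
  then show "x \<in> lp_seqs p" by (simp add: lp_seqs_def)
  have "(\<Sum>k. norm (x k) powr p) \<le> c powr p"
    using b s by (intro suminf_le_const) auto
  then have "lp_norm p x \<le> (c powr p) powr (1 / p)"
    unfolding lp_norm_def using s p by (intro powr_mono2) (auto intro: suminf_nonneg)
  then show "lp_norm p x \<le> c" using p c by (simp add: powr_powr)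
qed

lemma lp_seqs_diff:
  assumes "1 \<le> p" "x \<in> lp_seqs p" "y \<in> lp_seqs p"
  shows "(\<lambda>n. x n - y n) \<in> lp_seqs p"
  using lp_norm_triangle[OF assms(1,2), of "\<lambda>n. - y n"] assms(3) by (simp add: lp_seqs_def)

lemma norm_le_lp_norm:
  assumes p: "1 \<le> p" and x: "x \<in> lp_seqs p"
  shows "norm (x k) \<le> lp_norm p x"
proof -
  have s: "summable (\<lambda>k. norm (x k) powr p)" using x by (simp add: lp_seqs_def)
  have "norm (x k) powr p \<le> (\<Sum>k. norm (x k) powr p)"
    using sum_le_suminf[OF s, of "{k}"] by simp
  then have "(norm (x k) powr p) powr (1 / p) \<le> lp_norm p x"
    unfolding lp_norm_def using p by (intro powr_mono2) auto
  then show ?thesis using p by (simp add: powr_powr)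
qed

lemma sequence_metric_lp:
  assumes p: "1 \<le> p"
  shows "sequence_metric (lp_seqs p) (\<lambda>x y :: nat \<Rightarrow> 'a::real_normed_vector. lp_norm p (\<lambda>n. x n - y n))"
proof -
  interpret Metric_space "lp_seqs p" "\<lambda>x y :: nat \<Rightarrow> 'a. lp_norm p (\<lambda>n. x n - y n)"
    by (rule Metric_space_lp[OF p])
  show ?thesis
  proof
    fix x y :: "nat \<Rightarrow> 'a" and k and c :: real
    show "norm (x k - y k) \<le> lp_norm p (\<lambda>n. x n - y n)" if "x \<in> lp_seqs p" "y \<in> lp_seqs p"
      using norm_le_lp_norm[OF p lp_seqs_diff[OF p that]] .
    show "x \<in> lp_seqs p" if "\<And>M. (\<Sum>k<M. norm (x k)) \<le> c"
    proof (rule lp_of_sum_norm_le(1)[OF p])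
      show "0 < \<bar>c\<bar> + 1" by simp
      show "(\<Sum>k<M. norm (x k)) \<le> \<bar>c\<bar> + 1" for M using that[of M] by linarith
    qed
    show "lp_norm p (\<lambda>n. x n - y n) \<le> c"
      if "0 < c" "\<And>M. (\<Sum>k<M. norm (x k - y k)) \<le> c"
      using lp_of_sum_norm_le(2)[OF p that] .
    assume x: "x \<in> lp_seqs p" and c: "0 < c"
    have s: "summable (\<lambda>k. norm (x k) powr p)" using x by (simp add: lp_seqs_def)
    \<comment> \<open>The tail of this convergent series is the \<open>p\<close>-th power of the
      truncation error.\<close>
    obtain m where m: "norm (\<Sum>i. norm (x (i + m)) powr p) < c powr p"
      using suminf_exist_split[OF _ s, of "c powr p"] c by auto
    have z: "(\<lambda>k. norm (x k - (if k < m then x k else 0)) powr p) sums (\<Sum>i. norm (x (i + m)) powr p)"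
    proof -
      have "(\<lambda>i. norm (x (i + m)) powr p) sums (\<Sum>i. norm (x (i + m)) powr p)"
        using s by (intro summable_sums) (simp add: summable_iff_shift[of "\<lambda>k. norm (x k) powr p"])
      then show ?thesis
        by (subst sums_zero_iff_shift[of m, symmetric]) auto
    qed
    have "lp_norm p (\<lambda>k. x k - (if k < m then x k else 0)) < (c powr p) powr (1 / p)"
      unfolding lp_norm_def sums_unique[OF z, symmetric] using m p
      by (intro powr_less_mono2) (auto intro!: suminf_nonneg simp: s summable_iff_shift[of "\<lambda>k. norm (x k) powr p"])
    then show "\<exists>m. lp_norm p (\<lambda>n. x n - (if n < m then x n else 0)) < c"
      using p c by (auto simp: powr_powr)
  qed
qed

lemma c0_norm_le_dist:
  fixes x y :: "nat \<Rightarrow> 'a::real_normed_vector"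
  assumes "x \<in> c0_seqs" "y \<in> c0_seqs"
  shows "norm (x n - y n) \<le> c0_dist x y"
proof -
  have "(\<lambda>n. x n - y n) \<longlonglongrightarrow> 0"
    using tendsto_diff[of x 0 sequentially y 0] assms by (simp add: c0_seqs_def)
  then have "Bseq (\<lambda>n. x n - y n)"
    by (meson convergentI convergent_imp_Bseq)
  then have "bdd_above (range (\<lambda>n. norm (x n - y n)))"
    by (auto simp: Bseq_def bdd_above_def)
  then show ?thesis
    using assms by (auto simp: c0_dist_def intro: cSUP_upper)
qed

lemma c0_dist_le:
  assumes "x \<in> c0_seqs" "y \<in> c0_seqs" "\<And>n. norm (x n - y n) \<le> c"
  shows "c0_dist x y \<le> c"
  using assms by (auto simp: c0_dist_def intro: cSUP_least)

lemma sequence_metric_c0: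
  "sequence_metric c0_seqs (c0_dist :: (nat \<Rightarrow> 'a::real_normed_vector) \<Rightarrow> _)"
proof -
  interpret Metric_space c0_seqs "c0_dist :: (nat \<Rightarrow> 'a) \<Rightarrow> _"
    by (rule Metric_space_c0)
  show ?thesis
  proof
    fix x y :: "nat \<Rightarrow> 'a" and k and c :: real
    show "norm (x k - y k) \<le> c0_dist x y" if "x \<in> c0_seqs" "y \<in> c0_seqs"
      using c0_norm_le_dist[OF that] .
    show "x \<in> c0_seqs" if "\<And>M. (\<Sum>k<M. norm (x k)) \<le> c"
      using summable_LIMSEQ_zero[OF summable_of_sum_norm_le[OF that]]
      by (simp add: c0_seqs_def tendsto_norm_zero_iff)
    show "c0_dist x y \<le> c" if "x \<in> c0_seqs" "y \<in> c0_seqs" "\<And>M. (\<Sum>k<M. norm (x k - y k)) \<le> c"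
    proof (rule c0_dist_le[OF that(1,2)])
      show "norm (x n - y n) \<le> c" for n
        using member_le_sum[of n "{..<Suc n}" "\<lambda>k. norm (x k - y k)"] that(3)[of "Suc n"] by simp
    qed
    assume x: "x \<in> c0_seqs" and c: "0 < c"
    \<comment> \<open>Half of \<open>c\<close> leaves room, because a supremum of strict bounds is
      bounded only weakly.\<close>
    obtain m where m: "\<And>n. n \<ge> m \<Longrightarrow> norm (x n) < c / 2"
      using LIMSEQ_D[of x 0 "c / 2"] x c by (auto simp: c0_seqs_def)
    have "(\<lambda>k. if k < m then x k else 0) \<in> c0_seqs"
      unfolding c0_seqs_def mem_Collect_eq
      by (rule tendsto_eventually) (auto simp: eventually_sequentially intro!: exI[of _ m])
    then have "c0_dist x (\<lambda>k. if k < m then x k else 0) \<le> c / 2"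
      using m c by (intro c0_dist_le x) (auto simp: less_imp_le)
    then show "\<exists>m. c0_dist x (\<lambda>k. if k < m then x k else 0) < c"
      using c by (intro exI[of _ m]) auto
  qed
qed

section \<open>Coverings, blocks and elementary estimates\<close>

lemma shift_product_funpow:
  "(shift_product l ^^ n) x i k = exp (l $ i * real n) *\<^sub>R x i (n + k)"
  by (induction n arbitrary: k)
    (simp_all add: shift_product_def backward_shift_def algebra_simps exp_add)

text \<open>Assertion (b) for one fixed choice of \<open>\<tau>\<close>, \<open>N\<close> and
  \<open>K\<close>.\<close>

definition gap_covering :: "real \<Rightarrow> nat \<Rightarrow> (real ^ 'd::finite) set \<Rightarrow> bool" where
  "gap_covering \<tau> N K \<longleftrightarrow>
     (\<exists>(q::nat) (n :: nat \<Rightarrow> nat) (l :: nat \<Rightarrow> real ^ 'd).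
        q \<ge> 1 \<and> n 1 \<ge> N \<and> (\<forall>k\<in>{1..<q}. n (k + 1) \<ge> n k + N) \<and>
        (\<forall>k\<in>{1..q}. \<forall>i. 0 < l k $ i) \<and>
        K \<subseteq> (\<Union>k\<in>{1..q}. {x. \<forall>i. x $ i \<in> {l k $ i - \<tau> / real (n k) .. l k $ i}}) \<and>
        (\<forall>k\<in>{1..<q}. \<forall>i.
          l (k + 1) $ i * real (n (k + 1)) - l k $ i * real (n k) \<ge> real N))"

text \<open>The visiting time satisfies \<open>a \<le> n\<close>, so that it shifts away everything
  before the block, and \<open>n \<le> b\<close>, so that the factor it puts on later blocks is
  bounded as soon as \<open>b\<close> is known. The bound \<open>D\<close> makes the block harmless
  to earlier ones.\<close>

definition block :: "(real ^ 'd::finite) set \<Rightarrow> ('d \<Rightarrow> nat \<Rightarrow> 'a::real_normed_vector) \<Rightarrow> real \<Rightarrow>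
    nat \<Rightarrow> nat \<Rightarrow> real \<Rightarrow> ('d \<Rightarrow> nat \<Rightarrow> 'a) \<Rightarrow> bool" where
  "block K v e a b D u \<longleftrightarrow> a < b \<and> (\<forall>i k. k < a \<or> b \<le> k \<longrightarrow> u i k = 0) \<and>
     (\<forall>i M. (\<Sum>k<M. norm (u i k)) \<le> D) \<and>
     (\<forall>l\<in>K. \<exists>n. a \<le> n \<and> n \<le> b \<and>
       (\<forall>i M. (\<Sum>k<M. norm (exp (l $ i * real n) *\<^sub>R u i (n + k) - v i k)) \<le> e))"

text \<open>The right inverse of the \<open>n\<close>-th power of the backward shift.\<close>

definition forward_shift :: "nat \<Rightarrow> (nat \<Rightarrow> 'a::zero) \<Rightarrow> nat \<Rightarrow> 'a" where
  "forward_shift n y j = (if n \<le> j then y (j - n) else 0)"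

lemma sum_shift_le:
  fixes f :: "nat \<Rightarrow> real"
  assumes "\<And>k. 0 \<le> f k"
  shows "(\<Sum>k<M. f (n + k)) \<le> (\<Sum>k<n + M. f k)"
proof -
  have "(\<Sum>k<M. f (n + k)) = sum f ((+) n ` {..<M})"
    by (simp add: sum.reindex)
  also have "\<dots> \<le> (\<Sum>k<n + M. f k)"
    using assms by (intro sum_mono2) auto
  finally show ?thesis .
qed

lemma sum_norm_forward_shift:
  "(\<Sum>j<M. norm (forward_shift n y j)) = (\<Sum>j<M - n. norm (y j))"
  by (induction M) (auto simp: forward_shift_def Suc_diff_le)

lemma sum_powers_le:
  fixes r :: real
  assumes "0 \<le> r" "r \<le> 1 / 2" "finite A" "A \<subseteq> {1..}"
  shows "(\<Sum>k\<in>A. r ^ k) \<le> 2 * r"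
proof -
  obtain q where "A \<subseteq> {..q}"
    using assms(3) finite_nat_set_iff_bounded_le by auto
  then have "A \<subseteq> {1..q}" using assms(4) by auto
  then have "(\<Sum>k\<in>A. r ^ k) \<le> (\<Sum>k\<in>{1..q}. r ^ k)"
    using assms by (intro sum_mono2) auto
  \<comment> \<open>The subtracted term closes the induction: it at least halves at each
    step.\<close>
  also have "\<dots> \<le> 2 * r - 2 * r ^ (q + 1)"
  proof (induction q)
    case (Suc q)
    have "r * r ^ (q + 1) \<le> 1 / 2 * r ^ (q + 1)"
      using assms by (intro mult_right_mono) auto
    then show ?case using Suc by simp
  qed simp
  also have "\<dots> \<le> 2 * r" using assms by simp
  finally show ?thesis .
qed

lemma increments_le:
  fixes f :: "nat \<Rightarrow> real"
  assumes "\<And>k. k \<in> {1..<q} \<Longrightarrow> c \<le> f (k + 1) - f k" and "1 \<le> k" "k \<le> l" "l \<le> q"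
  shows "real (l - k) * c \<le> f l - f k"
  using assms(3,4)
proof (induction l rule: dec_induct)
  case (step l)
  then have "c \<le> f (l + 1) - f l" using assms(1)[of l] assms(2) by auto
  moreover have "real (Suc l - k) * c = real (l - k) * c + c"
    using step by (simp add: Suc_diff_le algebra_simps)
  ultimately show ?case using step by simp
qed simp

text \<open>Each of the finitely many coordinates attains a positive minimum on a nonempty compact
  \<open>K\<close>. With \<open>c \<le> 1\<close>, the single ratio \<open>exp (- c N)\<close> can
  later serve both for the sizes \<open>L k $ i * n k\<close> and for their increments.\<close>

lemma compact_coordinates_bounded_below:
  fixes K :: "(real ^ 'd::finite) set"
  assumes "compact K" "K \<subseteq> {l. \<forall>i. 0 < l $ i}"
  shows "\<exists>c. 0 < c \<and> c \<le> 1 \<and> (\<forall>l\<in>K. \<forall>i. c \<le> l $ i)"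
proof -
  have "\<exists>c>0. \<forall>l\<in>K. c \<le> l $ i" for i
  proof (cases "K = {}")
    case False
    have "continuous_on K (\<lambda>l. l $ i)" by (intro continuous_intros)
    then obtain x where "x \<in> K" "\<forall>l\<in>K. x $ i \<le> l $ i"
      using continuous_attains_inf[OF assms(1) False] by blast
    then show ?thesis using assms(2) by auto
  qed (auto intro: exI[of _ 1])
  then obtain c where c: "\<And>i. 0 < c i" "\<And>i l. l \<in> K \<Longrightarrow> c i \<le> l $ i" by metis
  define c' where "c' = Min (insert 1 (range c))"
  have "0 < c'" "c' \<le> 1" using c(1) by (auto simp: c'_def)
  moreover have "c' \<le> c i" for i unfolding c'_def by (rule Min_le) auto
  ultimately show ?thesis using c(2) by (intro exI[of _ c']) (auto intro: order_trans)
qed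

lemma finite_support_sum_norm_bound:
  fixes v :: "'d::finite \<Rightarrow> nat \<Rightarrow> 'a::real_normed_vector"
  assumes "\<And>i k. m \<le> k \<Longrightarrow> v i k = 0"
  shows "\<exists>V>0. \<forall>i M. (\<Sum>k<M. norm (v i k)) \<le> V"
proof (intro exI conjI allI)
  let ?V = "1 + (\<Sum>i\<in>UNIV. \<Sum>k<m. norm (v i k))"
  show "0 < ?V" by (intro add_pos_nonneg sum_nonneg) auto
  fix i M
  have "(\<Sum>k<M. norm (v i k)) = (\<Sum>k\<in>{..<M} \<inter> {..<m}. norm (v i k))"
    using assms[of _ i] by (intro sum.mono_neutral_right) (auto simp: not_less[symmetric])
  also have "\<dots> \<le> (\<Sum>k<m. norm (v i k))" by (intro sum_mono2) auto
  also have "\<dots> \<le> (\<Sum>i\<in>UNIV. \<Sum>k<m. norm (v i k))"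
    by (rule member_le_sum) (auto intro: sum_nonneg)
  finally show "(\<Sum>k<M. norm (v i k)) \<le> ?V" by simp
qed

section \<open>From coverings to a vector with good orbits\<close>

text \<open>The exponents \<open>L k $ i * n k\<close> of the retained boxes are at least
  \<open>c k N\<close>, and they increase by at least \<open>N\<close> from box to box. All sums are
  thus dominated by geometric series of ratio \<open>r = exp (- c N)\<close>, which is small for
  large \<open>N\<close>. Half of \<open>e\<close> pays for the width of the box, half for the later
  terms.\<close>

lemma block_exists:
  fixes K :: "(real ^ 'd::finite) set" and v :: "'d \<Rightarrow> nat \<Rightarrow> 'a::real_normed_vector"
  assumes K: "compact K" "K \<subseteq> {l. \<forall>i. 0 < l $ i}"
    and cov: "\<And>\<tau> N. 0 < \<tau> \<Longrightarrow> 1 \<le> N \<Longrightarrow> gap_covering \<tau> N K"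
    and supp: "\<And>i k. m \<le> k \<Longrightarrow> v i k = 0"
    and e: "0 < e" and D: "0 < D"
  shows "\<exists>u b. block K v e a b D u"
proof -
  obtain V where V: "0 < V" "\<And>i M. (\<Sum>k<M. norm (v i k)) \<le> V"
    using finite_support_sum_norm_bound[of m v] supp by auto
  obtain c where c: "0 < c" "c \<le> 1" "\<And>l i. l \<in> K \<Longrightarrow> c \<le> l $ i"
    using compact_coordinates_bounded_below[OF K] by auto
  \<comment> \<open>A ratio \<open>r \<le> \<rho>\<close> is at most 1/2 and makes the geometric
    bound \<open>2 * r * V\<close> at most \<open>e / 2\<close> and at most
    \<open>D\<close>.\<close>
  define \<rho> where "\<rho> = min (1 / 2) (min (e / 2) D / (2 * V))"
  have \<rho>: "0 < \<rho>" using e D V by (simp add: \<rho>_def)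
  obtain N0 where N0: "- ln \<rho> / c < real N0" using reals_Archimedean2 by blast
  \<comment> \<open>\<open>m\<close> keeps the shifted copies of \<open>v\<close> disjoint,
    \<open>a\<close> makes them start late enough, and \<open>N0\<close> gives
    \<open>r \<le> \<rho>\<close>.\<close>
  define N where "N = max (max 1 m) (max a N0)"
  have N: "1 \<le> N" "m \<le> N" "a \<le> N" "N0 \<le> N" by (auto simp: N_def)
  define r where "r = exp (- (c * real N))"
  have "- ln \<rho> < c * real N0" using N0 c by (simp add: field_simps)
  also have "\<dots> \<le> c * real N" using c N by simp
  finally have "exp (- (c * real N)) < exp (ln \<rho>)" by simp
  then have "r \<le> \<rho>" using \<rho> by (simp add: r_def)
  then have r: "0 \<le> r" "r \<le> 1 / 2" "2 * r * V \<le> e / 2" "2 * r * V \<le> D"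
    using V by (auto simp: \<rho>_def r_def field_simps)
  have r_pow: "r ^ k = exp (- (c * (real k * real N)))" for k
    by (simp add: r_def algebra_simps flip: exp_of_nat_mult)
  \<comment> \<open>Within a box the exponent varies by at most \<open>\<tau>\<close>, which costs
    at most \<open>\<tau> * V\<close> in the l1 norm.\<close>
  define \<tau> where "\<tau> = e / (2 * V)"
  have \<tau>: "0 < \<tau>" "\<tau> * V \<le> e / 2" using e V by (auto simp: \<tau>_def)
  obtain q n and L :: "nat \<Rightarrow> real ^ 'd" where
    n1: "N \<le> n 1" and n_step: "\<And>k. k \<in> {1..<q} \<Longrightarrow> n k + N \<le> n (k + 1)" and
    K_cov: "K \<subseteq> (\<Union>k\<in>{1..q}. {x. \<forall>i. x $ i \<in> {L k $ i - \<tau> / real (n k) .. L k $ i}})" and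
    L_step: "\<And>k i. k \<in> {1..<q} \<Longrightarrow> real N \<le> L (k + 1) $ i * real (n (k + 1)) - L k $ i * real (n k)"
    using cov[OF \<tau>(1) N(1)] unfolding gap_covering_def by blast
  have n_gap: "real (k' - k) * real N \<le> real (n k') - real (n k)"
    if "1 \<le> k" "k \<le> k'" "k' \<le> q" for k k'
  proof (rule increments_le[OF _ that])
    show "real N \<le> real (n (j + 1)) - real (n j)" if "j \<in> {1..<q}" for j
      using n_step[OF that] by linarith
  qed
  have n_ge: "real k * real N \<le> real (n k)" if "k \<in> {1..q}" for k
  proof -
    have "real (k - 1) * real N \<le> real (n k) - real (n 1)" using n_gap[of 1 k] that by auto
    moreover have "real k * real N = real (k - 1) * real N + real N"
      using that by (simp add: of_nat_diff algebra_simps)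
    ultimately show ?thesis using n1 by simp
  qed
  have n_ge_N: "N \<le> n k" if "k \<in> {1..q}" for k
  proof -
    have "1 * real N \<le> real k * real N" using that by (intro mult_right_mono) auto
    then show ?thesis using n_ge[OF that] by linarith
  qed
  have L_gap: "real (k' - k) * real N \<le> L k' $ i * real (n k') - L k $ i * real (n k)"
    if "1 \<le> k" "k \<le> k'" "k' \<le> q" for k k' i
    using increments_le[of q "real N" "\<lambda>k. L k $ i * real (n k)", OF L_step that] .
  text \<open>Boxes that miss \<open>K\<close> are discarded because nothing bounds their \<open>L k\<close> from below.\<close>
  define A where "A = {k \<in> {1..q}. \<exists>l\<in>K. \<forall>i. l $ i \<le> L k $ i}"
  have A: "finite A" "A \<subseteq> {1..q}" by (auto simp: A_def)
  have L_ge: "c * (real k * real N) \<le> L k $ i * real (n k)" if k: "k \<in> A" for k i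
  proof -
    have "c \<le> L k $ i" using k c(3) by (auto simp: A_def intro: order_trans)
    then show ?thesis using n_ge[of k] k A c(1) by (intro mult_mono) auto
  qed
  define u where "u i j = (\<Sum>k\<in>A. exp (- (L k $ i * real (n k))) *\<^sub>R forward_shift (n k) (v i) j)" for i j
  define b where "b = (\<Sum>k\<in>{1..q}. n k) + m + a + 1"
  have n_le_b: "n k + m \<le> b" if "k \<in> {1..q}" for k
    using member_le_sum[of k "{1..q}" n] that by (simp add: b_def)
  have "u i k = 0" if "k < a \<or> b \<le> k" for i k
    unfolding u_def
  proof (intro sum.neutral ballI)
    fix j assume "j \<in> A"
    then have "a \<le> n j" "n j + m \<le> b" using n_ge_N[of j] n_le_b[of j] A N by auto
    then show "exp (- (L j $ i * real (n j))) *\<^sub>R forward_shift (n j) (v i) k = 0"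
      using that supp[of "k - n j" i] by (auto simp: forward_shift_def)
  qed
  moreover have "(\<Sum>j<M. norm (u i j)) \<le> D" for i M
  proof -
    have "(\<Sum>j<M. norm (u i j))
        \<le> (\<Sum>j<M. \<Sum>k\<in>A. exp (- (L k $ i * real (n k))) * norm (forward_shift (n k) (v i) j))"
      unfolding u_def by (intro sum_mono order_trans[OF norm_sum]) simp
    also have "\<dots> = (\<Sum>k\<in>A. exp (- (L k $ i * real (n k))) * (\<Sum>j<M. norm (forward_shift (n k) (v i) j)))"
      by (subst sum.swap) (simp add: sum_distrib_left)
    also have "\<dots> \<le> (\<Sum>k\<in>A. r ^ k * V)"
      using L_ge V by (intro sum_mono mult_mono) (auto simp: r_pow sum_norm_forward_shift intro: sum_nonneg)
    also have "\<dots> \<le> 2 * r * V"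
      unfolding sum_distrib_right[symmetric]
      using A V r by (intro mult_right_mono sum_powers_le) auto
    finally show ?thesis using r by simp
  qed
  moreover have "\<exists>n. a \<le> n \<and> n \<le> b \<and>
      (\<forall>i M. (\<Sum>j<M. norm (exp (l $ i * real n) *\<^sub>R u i (n + j) - v i j)) \<le> e)" if l: "l \<in> K" for l
  proof -
    obtain k where k: "k \<in> {1..q}"
      and box: "\<And>i. L k $ i - \<tau> / real (n k) \<le> l $ i" "\<And>i. l $ i \<le> L k $ i"
      using K_cov l by fastforce
    have kA: "k \<in> A" using k box l by (auto simp: A_def)
    have nk: "0 < n k" "a \<le> n k" "n k \<le> b" using n_ge_N[OF k] n_le_b[OF k] N by auto
    have "(\<Sum>j<M. norm (exp (l $ i * real (n k)) *\<^sub>R u i (n k + j) - v i j)) \<le> e" for i M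
    proof -
      \<comment> \<open>\<open>w k'\<close> is the share of the \<open>k'\<close>-th term in the
        error at time \<open>n k\<close>, with \<open>v\<close> charged to the term
        \<open>k\<close>. Its bound \<open>g k'\<close> is 0 for earlier terms, \<open>e / 2\<close>
        for \<open>k\<close> itself and geometric for later ones.\<close>
      define E where "E k' = exp (l $ i * real (n k) - L k' $ i * real (n k'))" for k'
      define w where "w k' j = E k' *\<^sub>R forward_shift (n k') (v i) (n k + j)
          - (if k' = k then v i j else 0)" for k' j
      define g where "g k' = (if k' = k then e / 2 else 0) + (if k < k' then r ^ (k' - k) * V else 0)" for k'
      have w_sum: "(\<Sum>j<M. norm (w k' j)) \<le> g k'" if k': "k' \<in> A" for k'
      proof -
        consider "k' < k" | "k' = k" | "k < k'" by linarith
        then show ?thesis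
        proof cases
          case 1
          have "1 * real N \<le> real (k - k') * real N" using 1 by (intro mult_right_mono) auto
          then have "real N \<le> real (n k) - real (n k')"
            using n_gap[of k' k] 1 k k' A by force
          \<comment> \<open>The earlier copy of \<open>v\<close> ends before index
            \<open>n k\<close>, so the shift deletes it.\<close>
          then have "n k' + m \<le> n k" using N by linarith
          then have "w k' j = 0" for j
            using 1 supp by (auto simp: w_def forward_shift_def)
          then show ?thesis using 1 by (simp add: g_def)
        next
          case 2
          have "\<bar>E k - 1\<bar> \<le> \<tau>"
          proof -
            \<comment> \<open>The box confines \<open>t\<close> to \<open>[- \<tau>, 0]\<close>,
              where \<open>1 + t \<le> exp t \<le> 1\<close>.\<close>
            define t where "t = l $ i * real (n k) - L k $ i * real (n k)"
            have "- \<tau> \<le> t" "t \<le> 0"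
              using box[of i] nk by (auto simp: t_def field_simps)
            moreover have "exp t \<le> 1" using \<open>t \<le> 0\<close> by simp
            ultimately show ?thesis
              using exp_ge_add_one_self[of t] unfolding E_def t_def[symmetric] by linarith
          qed
          moreover have "w k j = (E k - 1) *\<^sub>R v i j" for j
            by (simp add: w_def forward_shift_def algebra_simps)
          ultimately have "(\<Sum>j<M. norm (w k j)) \<le> \<tau> * (\<Sum>j<M. norm (v i j))"
            by (auto simp: sum_distrib_left intro!: sum_mono mult_right_mono)
          also have "\<dots> \<le> \<tau> * V" using V \<tau> by (intro mult_left_mono) auto
          finally show ?thesis using 2 \<tau> by (simp add: g_def)
        next
          case 3
          \<comment> \<open>Here \<open>c \<le> 1\<close> makes the increment comparable with
            \<open>r\<close>; the upper side of the box then allows \<open>l\<close> to replace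
            \<open>L k\<close>.\<close>
          have "c * (real (k' - k) * real N) \<le> 1 * (real (k' - k) * real N)"
            using c by (intro mult_right_mono) auto
          also have "\<dots> \<le> L k' $ i * real (n k') - L k $ i * real (n k)"
            using L_gap[of k k' i] 3 k k' A by auto
          also have "\<dots> \<le> L k' $ i * real (n k') - l $ i * real (n k)"
            using box[of i] by (simp add: mult_right_mono)
          finally have E: "E k' \<le> r ^ (k' - k)" by (simp add: E_def r_pow)
          have "(\<Sum>j<M. norm (w k' j)) = E k' * (\<Sum>j<M. norm (forward_shift (n k') (v i) (n k + j)))"
            using 3 by (simp add: w_def sum_distrib_left E_def)
          also have "\<dots> \<le> E k' * (\<Sum>j<n k + M. norm (forward_shift (n k') (v i) j))"
            by (intro mult_left_mono sum_shift_le) (auto simp: E_def)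
          also have "\<dots> \<le> r ^ (k' - k) * V"
            using E V r by (intro mult_mono) (auto simp: sum_norm_forward_shift intro: sum_nonneg)
          finally show ?thesis using 3 by (simp add: g_def)
        qed
      qed
      have "exp (l $ i * real (n k)) *\<^sub>R u i (n k + j) - v i j = (\<Sum>k'\<in>A. w k' j)" for j
        using A kA by (simp add: u_def w_def E_def scaleR_sum_right sum_subtractf exp_diff exp_minus field_simps)
      then have "(\<Sum>j<M. norm (exp (l $ i * real (n k)) *\<^sub>R u i (n k + j) - v i j))
          \<le> (\<Sum>j<M. \<Sum>k'\<in>A. norm (w k' j))"
        by (auto intro: sum_mono norm_sum)
      also have "\<dots> = (\<Sum>k'\<in>A. \<Sum>j<M. norm (w k' j))" by (rule sum.swap)
      also have "\<dots> \<le> (\<Sum>k'\<in>A. g k')" by (intro sum_mono w_sum)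
      also have "\<dots> = e / 2 + (\<Sum>k'\<in>{k' \<in> A. k < k'}. r ^ (k' - k)) * V"
        using A kA by (auto simp: g_def sum.distrib sum.inter_filter sum_distrib_right intro!: sum.cong)
      also have "(\<Sum>k'\<in>{k' \<in> A. k < k'}. r ^ (k' - k)) = (\<Sum>j\<in>(\<lambda>k'. k' - k) ` {k' \<in> A. k < k'}. r ^ j)"
        by (subst sum.reindex) (auto simp: inj_on_def)
      also have "\<dots> \<le> 2 * r"
        using A r by (intro sum_powers_le) auto
      finally show ?thesis using r V by (simp add: mult_right_mono)
    qed
    then show ?thesis using nk by blast
  qed
  ultimately show ?thesis
    unfolding block_def by (intro exI[of _ u] exI[of _ b]) (auto simp: b_def)
qed

text \<open>Each block begins where the previous one ends, and its size is fixed only after that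
  index is known. Hence even after amplification at the visiting times of block \<open>j\<close>,
  all later blocks together contribute at most \<open>e j\<close>; the block's own error is the
  other \<open>e j\<close>.\<close>

lemma concatenate_blocks:
  fixes K :: "nat \<Rightarrow> (real ^ 'd::finite) set" and v :: "nat \<Rightarrow> 'd \<Rightarrow> nat \<Rightarrow> 'a::real_normed_vector"
  assumes R: "\<And>j l i. l \<in> K j \<Longrightarrow> l $ i \<le> R j" "\<And>j. 0 \<le> R j"
    and e: "\<And>j. 0 < e j"
    and step: "\<And>j a D. 0 < D \<Longrightarrow> \<exists>u b. block (K j) (v j) (e j) a b D u"
  shows "\<exists>x c. (\<forall>i M. (\<Sum>k<M. norm (x i k)) \<le> c) \<and>
    (\<forall>j. \<forall>l\<in>K j. \<exists>n. \<forall>i M. (\<Sum>k<M. norm (exp (l $ i * real n) *\<^sub>R x i (n + k) - v j i k)) \<le> 2 * e j)"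
proof -
  \<comment> \<open>A state is a start index with a size bound. As the bounds at least halve,
    \<open>2 * snd s'\<close> covers the next block and all its successors.\<close>
  define next_ok where "next_ok j s s' \<longleftrightarrow> (\<exists>u. block (K j) (v j) (e j) (fst s) (fst s') (snd s) u) \<and>
      snd s' \<le> snd s / 2 \<and> exp (R j * real (fst s')) * (2 * snd s') \<le> e j"
    for j and s s' :: "nat \<times> real"
  have "\<exists>f. \<forall>j. (0 < snd (f j) \<and> (j = 0 \<longrightarrow> fst (f j) = 0)) \<and> next_ok j (f j) (f (Suc j))"
  proof (rule dependent_nat_choice)
    \<comment> \<open>Starting at index 0 leaves no index before the first block.\<close>
    show "\<exists>s :: nat \<times> real. 0 < snd s \<and> (0 = (0::nat) \<longrightarrow> fst s = 0)"
      by (rule exI[of _ "(0, 1::real)"]) simp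
    fix s :: "nat \<times> real" and j :: nat assume s: "0 < snd s \<and> (j = 0 \<longrightarrow> fst s = 0)"
    obtain u b where "block (K j) (v j) (e j) (fst s) b (snd s) u" using step s by blast
    then show "\<exists>s'. (0 < snd s' \<and> (Suc j = 0 \<longrightarrow> fst s' = 0)) \<and> next_ok j s s'"
      using s e[of j]
      by (intro exI[of _ "(b, min (snd s / 2) (e j / (2 * exp (R j * real b))))"])
        (auto simp: next_ok_def min_def field_simps)
  qed
  then obtain f where f: "\<And>j. 0 < snd (f j)" "fst (f 0) = 0" "\<And>j. next_ok j (f j) (f (Suc j))"
    by blast
  define b D where "b j = fst (f j)" and "D j = snd (f j)" for j
  have D: "0 < D j" "D (Suc j) \<le> D j / 2" "exp (R j * real (b (Suc j))) * (2 * D (Suc j)) \<le> e j" for j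
    using f by (auto simp: D_def b_def next_ok_def)
  obtain u where u: "\<And>j. block (K j) (v j) (e j) (b j) (b (Suc j)) (D j) (u j)"
    using f(3) unfolding next_ok_def b_def D_def by metis
  have b0: "b 0 = 0" using f by (simp add: b_def)
  have u0: "u j i k = 0" if "k < b j \<or> b (Suc j) \<le> k" for j i k
    using u[of j] that by (auto simp: block_def)
  have uD: "(\<Sum>k<M. norm (u j i k)) \<le> D j" for j i M
    using u[of j] by (auto simp: block_def)
  have "strict_mono b"
    using u by (auto simp: strict_mono_Suc_iff block_def)
  then have b_mono: "b i \<le> b j" if "i \<le> j" for i j
    using that by (simp add: strict_mono_less_eq)
  have b_ge: "j \<le> b j" for j using \<open>strict_mono b\<close> by (simp add: strict_mono_imp_increasing)
  \<comment> \<open>The sum may stop at \<open>k\<close>, since block \<open>j\<close> starts at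
    \<open>b j \<ge> j\<close>; at most one term is nonzero.\<close>
  define x where "x i k = (\<Sum>j\<le>k. u j i k)" for i k
  have x_eq: "x i k = u j i k" if "b j \<le> k" "k < b (Suc j)" for i j k
  proof -
    have "u j' i k = 0" if "j' \<noteq> j" for j'
    proof (rule u0)
      show "k < b j' \<or> b (Suc j') \<le> k"
        using b_mono[of "Suc j" j'] b_mono[of "Suc j'" j] that \<open>b j \<le> k\<close> \<open>k < b (Suc j)\<close>
        by (cases "j < j'") auto
    qed
    moreover have "j \<le> k" using b_ge[of j] that by simp
    ultimately show ?thesis
      unfolding x_def by (subst sum.remove[of _ j]) auto
  qed
  have tail: "(\<Sum>k\<in>{b j..<T}. norm (x i k)) \<le> 2 * D j" for i j T
  proof -
    \<comment> \<open>Halving gives \<open>D j \<le> 2 * D j - 2 * D (Suc j)\<close>, so the bounds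
      of the blocks telescope.\<close>
    have "(\<Sum>k\<in>{b j..<b (j + M)}. norm (x i k)) \<le> 2 * D j - 2 * D (j + M)" for M
    proof (induction M)
      case (Suc M)
      have "(\<Sum>k\<in>{b (j + M)..<b (j + Suc M)}. norm (x i k))
          = (\<Sum>k\<in>{b (j + M)..<b (j + Suc M)}. norm (u (j + M) i k))"
        using x_eq[of "j + M"] by (intro sum.cong) auto
      also have "\<dots> \<le> (\<Sum>k<b (j + Suc M). norm (u (j + M) i k))"
        by (intro sum_mono2) auto
      also have "\<dots> \<le> D (j + M)" by (rule uD)
      finally show ?case
        using Suc D(2)[of "j + M"] sum.atLeastLessThan_concat[of "b j" "b (j + M)" "b (j + Suc M)" "\<lambda>k. norm (x i k)"]
          b_mono[of j "j + M"] b_mono[of "j + M" "j + Suc M"] by simp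
    qed simp
    from this[of T] have "(\<Sum>k\<in>{b j..<b (j + T)}. norm (x i k)) \<le> 2 * D j"
      using D(1)[of "j + T"] by linarith
    moreover have "(\<Sum>k\<in>{b j..<T}. norm (x i k)) \<le> (\<Sum>k\<in>{b j..<b (j + T)}. norm (x i k))"
      using b_ge[of "j + T"] by (intro sum_mono2) auto
    ultimately show ?thesis by simp
  qed
  have "(\<Sum>k<M. norm (x i k)) \<le> 2 * D 0" for i M
    using tail[where j = 0 and T = M and i = i] b0 by (simp add: lessThan_atLeast0)
  moreover have "\<exists>n. \<forall>i M. (\<Sum>k<M. norm (exp (l $ i * real n) *\<^sub>R x i (n + k) - v j i k)) \<le> 2 * e j"
    if l: "l \<in> K j" for j l
  proof -
    obtain n where n: "b j \<le> n" "n \<le> b (Suc j)"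
      and n_sum: "\<And>i M. (\<Sum>k<M. norm (exp (l $ i * real n) *\<^sub>R u j i (n + k) - v j i k)) \<le> e j"
      using u[of j] l unfolding block_def by blast
    have "(\<Sum>k<M. norm (exp (l $ i * real n) *\<^sub>R x i (n + k) - v j i k)) \<le> 2 * e j" for i M
    proof -
      \<comment> \<open>\<open>z\<close> records what lies beyond block \<open>j\<close>. Since
        \<open>b j \<le> n\<close>, earlier blocks are shifted away, and only block \<open>j\<close>
        and \<open>z\<close> matter.\<close>
      define z where "z k = (if b (Suc j) \<le> k then norm (x i k) else 0)" for k
      have "(\<Sum>k<M. z (n + k)) \<le> (\<Sum>k<n + M. z k)"
        by (rule sum_shift_le) (simp add: z_def)
      also have "\<dots> = (\<Sum>k\<in>{b (Suc j)..<n + M}. norm (x i k))"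
        unfolding z_def by (subst sum.inter_filter[symmetric]) (auto intro: sum.cong)
      also have "\<dots> \<le> 2 * D (Suc j)" by (rule tail)
      finally have z: "(\<Sum>k<M. z (n + k)) \<le> 2 * D (Suc j)" .
      have "l $ i * real n \<le> R j * real (b (Suc j))"
        using R(1)[OF l] R(2)[of j] n by (intro mult_mono) auto
      then have "exp (l $ i * real n) * (\<Sum>k<M. z (n + k)) \<le> exp (R j * real (b (Suc j))) * (2 * D (Suc j))"
        using z by (intro mult_mono) (auto simp: z_def intro: sum_nonneg)
      also have "\<dots> \<le> e j" by (rule D)
      finally have zE: "exp (l $ i * real n) * (\<Sum>k<M. z (n + k)) \<le> e j" .
      have "norm (exp (l $ i * real n) *\<^sub>R x i (n + k) - v j i k)
          \<le> norm (exp (l $ i * real n) *\<^sub>R u j i (n + k) - v j i k) + exp (l $ i * real n) * z (n + k)" for k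
      proof (cases "b (Suc j) \<le> n + k")
        case True
        then show ?thesis
          using norm_triangle_ineq[of "exp (l $ i * real n) *\<^sub>R x i (n + k)" "- v j i k"]
          by (simp add: u0 z_def)
      next
        case False
        then show ?thesis using x_eq[of j "n + k" i] n by (simp add: z_def)
      qed
      then have "(\<Sum>k<M. norm (exp (l $ i * real n) *\<^sub>R x i (n + k) - v j i k))
          \<le> (\<Sum>k<M. norm (exp (l $ i * real n) *\<^sub>R u j i (n + k) - v j i k)) + exp (l $ i * real n) * (\<Sum>k<M. z (n + k))"
        unfolding sum_distrib_left sum.distrib[symmetric] by (rule sum_mono)
      then show ?thesis using n_sum[where i = i and M = M] zE by linarith
    qed
    then show ?thesis by blast
  qed
  ultimately show ?thesis by blast
qed

lemma countable_finite_support: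
  fixes D :: "'a::zero set"
  assumes "countable D"
  shows "countable {\<lambda>(i::'d::finite) k. if k < length (L i) then L i ! k else 0 | L. \<forall>i. set (L i) \<subseteq> D}"
proof -
  have "countable (PiE UNIV (\<lambda>i::'d. lists D))"
    using assms by (intro countable_PiE) auto
  then have "countable ((\<lambda>L (i::'d) k. if k < length (L i) then L i ! k else 0) ` PiE UNIV (\<lambda>i::'d. lists D))"
    by (rule countable_image)
  then show ?thesis
    by (rule countable_subset[rotated]) (auto simp: image_iff subset_iff)
qed

text \<open>A task is a compact piece, a finitely supported target with entries in a countable dense
  set, and an accuracy. There are countably many tasks, so one sequence of blocks serves them all,
  and any other target is close to that of some task.\<close>

lemma l1_common_approximation:
  fixes K :: "nat \<Rightarrow> (real ^ 'd::finite) set"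
  assumes K: "\<And>j. compact (K j)" "\<And>j. K j \<subseteq> {l. \<forall>i. 0 < l $ i}"
    and cov: "\<And>j \<tau> N. 0 < \<tau> \<Longrightarrow> 1 \<le> N \<Longrightarrow> gap_covering \<tau> N (K j)"
  shows "\<exists>(x :: 'd \<Rightarrow> nat \<Rightarrow> 'a::{real_normed_vector, second_countable_topology}) c.
    (\<forall>i M. (\<Sum>k<M. norm (x i k)) \<le> c) \<and>
    (\<forall>j. \<forall>l\<in>K j. \<forall>v m e. (\<forall>i k. m \<le> k \<longrightarrow> v i k = 0) \<and> 0 < e \<longrightarrow>
      (\<exists>n. \<forall>i M. (\<Sum>k<M. norm (exp (l $ i * real n) *\<^sub>R x i (n + k) - v i k)) \<le> e))"
proof -
  obtain D :: "'a set" where D: "countable D" "\<And>U. open U \<Longrightarrow> U \<noteq> {} \<Longrightarrow> \<exists>y\<in>D. y \<in> U"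
    using countable_dense_setE by blast
  define Q where "Q = {\<lambda>(i::'d) k. if k < length (L i) then L i ! k else 0 | L. \<forall>i. set (L i) \<subseteq> D}"
  have "countable Q" unfolding Q_def by (rule countable_finite_support[OF D(1)])
  define tasks where "tasks = (UNIV :: nat set) \<times> Q \<times> (UNIV :: nat set)"
  have "countable tasks" unfolding tasks_def using \<open>countable Q\<close> by auto
  have "(\<lambda>i k. 0) \<in> Q" unfolding Q_def by (rule CollectI) (rule exI[of _ "\<lambda>i. []"], auto)
  then have "tasks \<noteq> {}" by (auto simp: tasks_def)
  define t where "t = from_nat_into tasks"
  have t_in: "t s \<in> tasks" for s unfolding t_def by (rule from_nat_into[OF \<open>tasks \<noteq> {}\<close>])
  define K' v' e' where "K' s = K (fst (t s))" and "v' s = fst (snd (t s))"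
    and "e' s = 1 / real (Suc (snd (snd (t s))))" for s
  have "\<exists>R\<ge>0. \<forall>l\<in>K j. \<forall>i. l $ i \<le> R" for j
  proof -
    obtain B where "\<And>l. l \<in> K j \<Longrightarrow> norm l \<le> B"
      using compact_imp_bounded[OF K(1)] unfolding bounded_iff by blast
    then have "l $ i \<le> \<bar>B\<bar>" if "l \<in> K j" for l i
      using component_le_norm_cart[of l i] that by fastforce
    then show ?thesis by (intro exI[of _ "\<bar>B\<bar>"]) auto
  qed
  then obtain R where R: "\<And>j. 0 \<le> R j" "\<And>j l i. l \<in> K j \<Longrightarrow> l $ i \<le> R j" by metis
  have "\<exists>u b. block (K' s) (v' s) (e' s) a b \<delta> u" if \<delta>: "0 < \<delta>" for s a \<delta>
  proof -
    have "v' s \<in> Q" using t_in[of s] by (auto simp: v'_def tasks_def)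
    then obtain L where L: "v' s = (\<lambda>i k. if k < length (L i) then L i ! k else 0)"
      unfolding Q_def by blast
    show ?thesis
      unfolding K'_def
    proof (rule block_exists[OF K cov _ _ \<delta>, where m = "Max (range (\<lambda>i. length (L i)))"])
      show "v' s i k = 0" if "Max (range (\<lambda>i. length (L i))) \<le> k" for i k
      proof -
        have "length (L i) \<le> Max (range (\<lambda>i. length (L i)))" by (rule Max_ge) auto
        then have "length (L i) \<le> k" using that by (rule order_trans)
        then show ?thesis by (simp add: L)
      qed
    qed (auto simp: e'_def)
  qed
  then have "\<exists>x c. (\<forall>i M. (\<Sum>k<M. norm (x i k)) \<le> c) \<and> (\<forall>s. \<forall>l\<in>K' s.
      \<exists>n. \<forall>i M. (\<Sum>k<M. norm (exp (l $ i * real n) *\<^sub>R x i (n + k) - v' s i k)) \<le> 2 * e' s)"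
    using R by (intro concatenate_blocks[where R = "\<lambda>s. R (fst (t s))"]) (auto simp: K'_def e'_def)
  then obtain x c where x: "\<And>i M. (\<Sum>k<M. norm (x i k)) \<le> c"
    and x_near: "\<And>s l. l \<in> K' s \<Longrightarrow>
      \<exists>n. \<forall>i M. (\<Sum>k<M. norm (exp (l $ i * real n) *\<^sub>R x i (n + k) - v' s i k)) \<le> 2 * e' s"
    by blast
  have "\<exists>n. \<forall>i M. (\<Sum>k<M. norm (exp (l $ i * real n) *\<^sub>R x i (n + k) - v i k)) \<le> e"
    if l: "l \<in> K j" and v: "\<And>i k. m \<le> k \<Longrightarrow> v i k = 0" and e: "0 < e"
    for j l m e and v :: "'d \<Rightarrow> nat \<Rightarrow> 'a"
  proof -
    \<comment> \<open>At most \<open>m\<close> entries are replaced, for a total cost of at most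
      \<open>e / 2\<close>; \<open>Suc m\<close> avoids a zero denominator.\<close>
    have "\<exists>y\<in>D. dist (v i k) y < e / (2 * real (Suc m))" for i k
    proof -
      have "0 < e / (2 * real (Suc m))" using e by (simp del: of_nat_Suc)
      then show ?thesis using D(2)[OF open_ball, of "v i k" "e / (2 * real (Suc m))"]
        by (metis ball_eq_empty mem_ball not_le)
    qed
    then obtain y where y: "\<And>i k. y i k \<in> D" "\<And>i k. dist (v i k) (y i k) < e / (2 * real (Suc m))"
      by metis
    define w where "w = (\<lambda>i k. if k < m then y i k else 0)"
    have "w \<in> Q" unfolding Q_def
      by (rule CollectI, rule exI[of _ "\<lambda>i. map (y i) [0..<m]"]) (auto simp: w_def y fun_eq_iff)
    \<comment> \<open>The concatenation doubles the accuracy \<open>1 / Suc r\<close>, so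
      \<open>e / 4\<close> leads to \<open>e / 2\<close>.\<close>
    obtain r where r: "1 / real (Suc r) < e / 4" using nat_approx_posE[of "e / 4"] e by auto
    have "(j, w, r) \<in> tasks" using \<open>w \<in> Q\<close> by (simp add: tasks_def)
    then obtain s where s: "t s = (j, w, r)"
      using from_nat_into_surj[OF \<open>countable tasks\<close>] unfolding t_def by blast
    obtain n where n: "\<And>i M. (\<Sum>k<M. norm (exp (l $ i * real n) *\<^sub>R x i (n + k) - w i k)) \<le> 2 * (1 / real (Suc r))"
      using x_near[of l s] l by (auto simp: K'_def v'_def e'_def s)
    have vw: "(\<Sum>k<M. norm (w i k - v i k)) \<le> e / 2" for i M
    proof -
      have "(\<Sum>k<M. norm (w i k - v i k)) = (\<Sum>k\<in>{..<M} \<inter> {..<m}. norm (w i k - v i k))"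
        using v[of _ i] by (intro sum.mono_neutral_right) (auto simp: w_def not_less[symmetric])
      also have "\<dots> \<le> (\<Sum>k\<in>{..<M} \<inter> {..<m}. e / (2 * real (Suc m)))"
        using y(2)[of i] by (intro sum_mono) (auto simp: w_def dist_norm norm_minus_commute less_imp_le)
      also have "\<dots> \<le> (\<Sum>k<m. e / (2 * real (Suc m)))"
        using e by (intro sum_mono2) auto
      also have "\<dots> \<le> e / 2" using e by (simp add: field_simps)
      finally show ?thesis .
    qed
    have "(\<Sum>k<M. norm (exp (l $ i * real n) *\<^sub>R x i (n + k) - v i k)) \<le> e" for i M
    proof -
      have "(\<Sum>k<M. norm (exp (l $ i * real n) *\<^sub>R x i (n + k) - v i k))
          \<le> (\<Sum>k<M. norm (exp (l $ i * real n) *\<^sub>R x i (n + k) - w i k) + norm (w i k - v i k))"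
        by (intro sum_mono norm_diff_triangle_le) auto
      also have "\<dots> \<le> e"
        using n[where i = i and M = M] vw[where i = i and M = M] r by (simp add: sum.distrib)
      finally show ?thesis .
    qed
    then show ?thesis by blast
  qed
  then show ?thesis using x by (intro exI[of _ x] exI[of _ c]) blast
qed

section \<open>From visits of an orbit to coverings\<close>

text \<open>A visit at time \<open>n\<close> pins \<open>l $ i * n + ln (y i n)\<close> between
  \<open>ln (1 - \<epsilon>)\<close> and \<open>ln (1 + \<epsilon>)\<close>, which places
  \<open>l\<close> in a box depending only on \<open>n\<close> and \<open>x\<close>. Compactness
  leaves finitely many times.\<close>

lemma gap_covering_of_visits:
  fixes K :: "(real ^ 'd::finite) set" and x :: "'d \<Rightarrow> nat \<Rightarrow> 'a::real_normed_vector"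
  assumes K: "compact K" "K \<subseteq> {l. \<forall>i. 0 < l $ i}"
    and w: "norm w = 1" and \<tau>: "0 < \<tau>" and N: "1 \<le> N"
    and visits: "\<And>\<epsilon> l. 0 < \<epsilon> \<Longrightarrow> l \<in> K \<Longrightarrow> \<exists>n\<ge>N. \<forall>i.
      norm (exp (l $ i * real n) *\<^sub>R x i (n + N) - w) < \<epsilon> \<and>
      (\<forall>j. j \<noteq> N \<longrightarrow> norm (exp (l $ i * real n) *\<^sub>R x i (n + j)) < \<epsilon>)"
  shows "gap_covering \<tau> N K"
proof -
  \<comment> \<open>The first bound makes the logarithmic window at most
    \<open>3 * \<epsilon> \<le> \<tau>\<close> wide, the second produces the factor
    \<open>exp (- N)\<close> in the domination of the other entries.\<close>
  define \<epsilon> where "\<epsilon> = min (\<tau> / 4) (exp (- real N) / 2)"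
  have "exp (- real N) < 1" using N by simp
  moreover have "\<epsilon> \<le> \<tau> / 4" "\<epsilon> \<le> exp (- real N) / 2" by (simp_all add: \<epsilon>_def)
  moreover have "0 < \<epsilon>" using \<tau> by (simp add: \<epsilon>_def)
  ultimately have \<epsilon>: "0 < \<epsilon>" "\<epsilon> < 1 / 2" "4 * \<epsilon> \<le> \<tau>" "2 * \<epsilon> \<le> exp (- real N)"
    by linarith+
  have ln_gap: "ln (1 + \<epsilon>) - \<tau> \<le> ln (1 - \<epsilon>)"
  proof -
    have "ln (1 + \<epsilon>) \<le> \<epsilon>" using \<epsilon> by (intro ln_add_one_self_le_self) auto
    moreover have "- \<epsilon> - 2 * \<epsilon>\<^sup>2 \<le> ln (1 - \<epsilon>)"
      using \<epsilon> by (intro ln_one_minus_pos_lower_bound) auto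
    moreover have "\<epsilon>\<^sup>2 \<le> \<epsilon> * (1 / 2)"
      using \<epsilon> unfolding power2_eq_square by (intro mult_left_mono) auto
    ultimately show ?thesis using \<epsilon> by linarith
  qed
  define y where "y i n = norm (x i (n + N))" for i n
  \<comment> \<open>\<open>near n\<close> involves finitely many conditions and is therefore open.
    The infinitely many conditions on the other entries are asked in \<open>G\<close> of a single
    witness, since they only serve to compare entries of \<open>x\<close>.\<close>
  define near where "near n = {l. \<forall>i. norm (exp (l $ i * real n) *\<^sub>R x i (n + N) - w) < \<epsilon>}" for n
  define G where "G = {n. N \<le> n \<and> (\<exists>l\<in>K. l \<in> near n \<and>
      (\<forall>i j. j \<noteq> N \<longrightarrow> norm (exp (l $ i * real n) *\<^sub>R x i (n + j)) < \<epsilon>))}"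
  have y_bounds: "1 - \<epsilon> < exp (l $ i * real n) * y i n" "exp (l $ i * real n) * y i n < 1 + \<epsilon>"
    if "l \<in> near n" for l n i
  proof -
    have "norm (exp (l $ i * real n) *\<^sub>R x i (n + N) - w) < \<epsilon>" using that by (simp add: near_def)
    moreover have "norm (exp (l $ i * real n) *\<^sub>R x i (n + N)) = exp (l $ i * real n) * y i n"
      by (simp add: y_def)
    ultimately show "1 - \<epsilon> < exp (l $ i * real n) * y i n" "exp (l $ i * real n) * y i n < 1 + \<epsilon>"
      using norm_triangle_ineq3[of "exp (l $ i * real n) *\<^sub>R x i (n + N)" w] w by linarith+
  qed
  have y_pos: "0 < y i n" if n: "n \<in> G" for i n
  proof -
    obtain l where "l \<in> near n" using n by (auto simp: G_def)
    then have "y i n \<noteq> 0" using y_bounds(1)[of l n i] \<epsilon> by auto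
    then show ?thesis by (simp add: y_def)
  qed
  text \<open>Along a used time the coordinate \<open>N\<close> dominates, which both separates the used times
    and makes \<open>ln (y i n)\<close> drop by \<open>N\<close> from one to the next.\<close>
  have small: "norm (x i (n + j)) < exp (- real N) * y i n" if n: "n \<in> G" and j: "j \<noteq> N" for n j i
  proof -
    obtain l where l: "l \<in> near n" and lj: "exp (l $ i * real n) * norm (x i (n + j)) < \<epsilon>"
      using n j by (force simp: G_def)
    have "norm (x i (n + j)) * (1 / 2) \<le> norm (x i (n + j)) * (exp (l $ i * real n) * y i n)"
      using y_bounds(1)[OF l, of i] \<epsilon> by (intro mult_left_mono) auto
    also have "\<dots> = (exp (l $ i * real n) * norm (x i (n + j))) * y i n" by simp
    also have "\<dots> < \<epsilon> * y i n" using lj y_pos[OF n] by (rule mult_strict_right_mono)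
    finally have "norm (x i (n + j)) < (2 * \<epsilon>) * y i n" by simp
    also have "\<dots> \<le> exp (- real N) * y i n" using \<epsilon> y_pos[OF n, of i] by (intro mult_right_mono) auto
    finally show ?thesis .
  qed
  have y_less: "y i n' < exp (- real N) * y i n" if "n \<in> G" "n < n'" for n n' i
    \<comment> \<open>Index \<open>n' + N\<close> is seen from time \<open>n\<close> at an offset
      other than \<open>N\<close>.\<close>
    using small[of n "n' + N - n" i] that by (simp add: y_def)
  have separated: "n + N \<le> n'" if n: "n \<in> G" "n' \<in> G" "n < n'" for n n'
  \<comment> \<open>If the times were closer, index \<open>n + N\<close> would be visible from
    \<open>n'\<close> as well, and \<open>y i n\<close> and \<open>y i n'\<close> would each be
    smaller than the other.\<close>
  proof (rule ccontr)
    assume "\<not> n + N \<le> n'"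
    define i :: 'd where "i = undefined"
    have "y i n < exp (- real N) * y i n'"
      using small[of n' "n + N - n'" i] \<open>\<not> n + N \<le> n'\<close> n by (simp add: y_def)
    also have "\<dots> \<le> 1 * y i n'" using y_pos[OF n(2), of i] by (intro mult_right_mono) auto
    also have "\<dots> < exp (- real N) * y i n" using y_less[OF n(1,3), of i] by simp
    also have "\<dots> \<le> 1 * y i n" using y_pos[OF n(1), of i] by (intro mult_right_mono) auto
    finally show False by simp
  qed
  have ln_y: "real N \<le> ln (y i n) - ln (y i n')" if n: "n \<in> G" "n' \<in> G" "n < n'" for n n' i
  proof -
    have "ln (y i n') \<le> ln (exp (- real N) * y i n)"
      using y_less[OF n(1,3), of i] y_pos[OF n(2), of i] by (intro ln_mono) auto
    also have "\<dots> = - real N + ln (y i n)" using y_pos[OF n(1), of i] by (simp add: ln_mult)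
    finally show ?thesis by simp
  qed
  \<comment> \<open>The largest \<open>l $ i\<close> with
    \<open>exp (l $ i * n) * y i n \<le> 1 + \<epsilon>\<close>. In differences of
    \<open>L n $ i * n\<close> only \<open>ln (y i n)\<close> survives, so \<open>ln_y\<close> gives
    (ii).\<close>
  define L where "L n = (\<chi> i. (ln (1 + \<epsilon>) - ln (y i n)) / real n)" for n :: nat
  have box: "L n $ i - \<tau> / real n \<le> l $ i" "l $ i \<le> L n $ i" if n: "n \<in> G" and l: "l \<in> near n" for n l i
  proof -
    have n0: "0 < real n" using n N by (auto simp: G_def)
    have ln_e: "ln (exp (l $ i * real n) * y i n) = l $ i * real n + ln (y i n)"
      using y_pos[OF n, of i] by (simp add: ln_mult)
    have "ln (1 - \<epsilon>) \<le> l $ i * real n + ln (y i n)"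
      using y_bounds(1)[OF l, of i] \<epsilon> unfolding ln_e[symmetric] by (intro ln_mono) auto
    moreover have "l $ i * real n + ln (y i n) \<le> ln (1 + \<epsilon>)"
      using y_bounds[OF l, of i] \<epsilon> unfolding ln_e[symmetric] by (intro ln_mono) auto
    moreover have "L n $ i - \<tau> / real n = (ln (1 + \<epsilon>) - ln (y i n) - \<tau>) / real n"
      by (simp add: L_def diff_divide_distrib)
    ultimately show "L n $ i - \<tau> / real n \<le> l $ i" "l $ i \<le> L n $ i"
      using ln_gap n0 by (simp_all add: L_def pos_divide_le_eq pos_le_divide_eq)
  qed
  have "open (near n)" for n
  proof -
    have "near n = (\<Inter>i\<in>UNIV. {l. norm (exp (l $ i * real n) *\<^sub>R x i (n + N) - w) < \<epsilon>})"
      by (auto simp: near_def)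
    also have "open \<dots>" by (intro open_INT ballI open_Collect_less continuous_intros) auto
    finally show ?thesis .
  qed
  moreover have "K \<subseteq> (\<Union>n\<in>G. near n)"
  proof
    fix l assume l: "l \<in> K"
    obtain n where "n \<ge> N" "\<forall>i. norm (exp (l $ i * real n) *\<^sub>R x i (n + N) - w) < \<epsilon> \<and>
        (\<forall>j. j \<noteq> N \<longrightarrow> norm (exp (l $ i * real n) *\<^sub>R x i (n + j)) < \<epsilon>)"
      using visits[OF \<epsilon>(1) l] by blast
    then show "l \<in> (\<Union>n\<in>G. near n)" using l by (auto simp: G_def near_def)
  qed
  ultimately obtain F where F: "F \<subseteq> G" "finite F" "K \<subseteq> (\<Union>n\<in>F. near n)"
    using compactE_image[OF K(1), of G near] by metis
  show ?thesis
  proof (cases "F = {}")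
    case True
    then have "K = {}" using F by auto
    \<comment> \<open>One dummy box is supplied because \<open>q \<ge> 1\<close>.\<close>
    then show ?thesis
      unfolding gap_covering_def
      by (intro exI[of _ 1] exI[of _ "\<lambda>_. N"] exI[of _ "\<lambda>_. \<chi> i. 1"]) auto
  next
    case False
    define ns where "ns = sorted_list_of_set F"
    have ns: "set ns = F" "sorted_wrt (<) ns" "length ns \<ge> 1"
      using F False by (auto simp: ns_def Suc_le_eq card_gt_0_iff)
    define q where "q = length ns"
    \<comment> \<open>Times are numbered from 1, list positions from 0.\<close>
    define n where "n k = ns ! (k - 1)" for k
    have n_F: "n k \<in> F" if "k \<in> {1..q}" for k
    proof -
      have "ns ! (k - 1) \<in> set ns" using that by (intro nth_mem) (auto simp: q_def)
      then show ?thesis by (simp add: n_def ns)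
    qed
    then have n_G: "n k \<in> G" if "k \<in> {1..q}" for k using F that by auto
    have F_n: "\<exists>k\<in>{1..q}. m = n k" if "m \<in> F" for m
    proof -
      have "m \<in> set ns" using that ns(1) by simp
      then obtain j where "j < length ns" "ns ! j = m" unfolding in_set_conv_nth by blast
      then show ?thesis by (intro bexI[of _ "Suc j"]) (auto simp: n_def q_def)
    qed
    have n_less: "n k < n (k + 1)" if "k \<in> {1..<q}" for k
      using that sorted_wrt_nth_less[OF ns(2), of "k - 1" k] by (auto simp: n_def q_def)
    have step: "n k \<in> G" "n (k + 1) \<in> G" "n k < n (k + 1)" if "k \<in> {1..<q}" for k
      using that n_G n_less by auto
    have "1 \<le> q" "n 1 \<in> G" using ns n_G[of 1] by (auto simp: q_def)
    moreover have "N \<le> n 1" using \<open>n 1 \<in> G\<close> by (simp add: G_def)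
    moreover have "\<forall>k\<in>{1..<q}. n (k + 1) \<ge> n k + N" using separated step by blast
    moreover have "\<forall>k\<in>{1..q}. \<forall>i. 0 < L (n k) $ i"
    proof (intro ballI allI)
      fix k i assume k: "k \<in> {1..q}"
      obtain l where "l \<in> K" "l \<in> near (n k)" using n_G[OF k] by (auto simp: G_def)
      moreover have "0 < l $ i" using \<open>l \<in> K\<close> K(2) by blast
      ultimately show "0 < L (n k) $ i" using box(2)[OF n_G[OF k], of l i] by simp
    qed
    moreover have "K \<subseteq> (\<Union>k\<in>{1..q}. {x. \<forall>i. x $ i \<in> {L (n k) $ i - \<tau> / real (n k) .. L (n k) $ i}})"
    proof
      fix l assume "l \<in> K"
      then obtain k where k: "k \<in> {1..q}" "l \<in> near (n k)" using F F_n by fastforce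
      then show "l \<in> (\<Union>k\<in>{1..q}. {x. \<forall>i. x $ i \<in> {L (n k) $ i - \<tau> / real (n k) .. L (n k) $ i}})"
        using box[OF n_G[OF k(1)] k(2)] by (intro UN_I[OF k(1)]) simp
    qed
    moreover have "\<forall>k\<in>{1..<q}. \<forall>i.
        L (n (k + 1)) $ i * real (n (k + 1)) - L (n k) $ i * real (n k) \<ge> real N"
    proof (intro ballI allI)
      fix k i assume k: "k \<in> {1..<q}"
      have "L m $ i * real m = ln (1 + \<epsilon>) - ln (y i m)" if "m \<in> G" for m
        using that N by (simp add: L_def G_def)
      then show "L (n (k + 1)) $ i * real (n (k + 1)) - L (n k) $ i * real (n k) \<ge> real N"
        using ln_y[OF step[OF k], of i] step[OF k] by simp
    qed
    ultimately show ?thesis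
      unfolding gap_covering_def
      by (intro exI[of _ q] exI[of _ n] exI[of _ "\<lambda>k. L (n k)"] conjI)
  qed
qed

section \<open>Hypercyclicity in the product topology\<close>

context sequence_metric
begin

lemma topspace_product: "topspace (product_topology (\<lambda>i::'d. mtopology) UNIV) = {x. \<forall>i. x i \<in> S}"
  by (auto simp: PiE_iff)

text \<open>Density alone gives a visit, possibly an early one. The first \<open>N\<close> iterates
  are therefore removed from the neighbourhood; it stays nonempty because it contains the infinitely
  many points \<open>z s\<close> with \<open>0 < s < \<epsilon>\<close>.\<close>

lemma hypercyclic_visits:
  fixes x :: "'d::finite \<Rightarrow> nat \<Rightarrow> 'a"
  assumes hyp: "hypercyclic_vector (product_topology (\<lambda>i::'d. mtopology) UNIV) (shift_product l) x"
    and w: "norm w = 1" and \<epsilon>: "0 < \<epsilon>"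
  shows "\<exists>n\<ge>N. \<forall>i. norm (exp (l $ i * real n) *\<^sub>R x i (n + m) - w) < \<epsilon> \<and>
      (\<forall>j. j \<noteq> m \<longrightarrow> norm (exp (l $ i * real n) *\<^sub>R x i (n + j)) < \<epsilon>)"
proof -
  let ?Y = "product_topology (\<lambda>i::'d. mtopology) UNIV"
  define z where "z s = (\<lambda>k. if k = m then (1 + s) *\<^sub>R w else 0)" for s :: real
  have sum_z: "(\<Sum>k<M. norm (z s k - (if k = m then t *\<^sub>R w else 0))) \<le> \<bar>1 + s - t\<bar>" for s t M
  proof -
    have "norm (z s k - (if k = m then t *\<^sub>R w else 0)) = (if k = m then \<bar>1 + s - t\<bar> else 0)" for k
      using w by (simp add: z_def flip: scaleR_left_diff_distrib)
    then show ?thesis by simp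
  qed
  have z_S: "z s \<in> S" for s
    using sum_z[of s 0] by (intro mem_of_l1[of _ "\<bar>1 + s\<bar>"]) (simp cong: if_cong)
  define W where "W = PiE UNIV (\<lambda>_::'d. mball (z 0) \<epsilon>)"
  \<comment> \<open>Intersecting with the space makes \<open>F\<close> a finite set of its points,
    hence closed by the Hausdorff property.\<close>
  define F where "F = (\<lambda>n. (shift_product l ^^ n) x) ` {..<N} \<inter> topspace ?Y"
  have "inj_on (\<lambda>s (i::'d). z s) {0<..<\<epsilon>}"
  proof (rule inj_onI)
    fix s t assume "(\<lambda>i::'d. z s) = (\<lambda>i. z t)"
    then have "z s m = z t m" by metis
    then have "(s - t) *\<^sub>R w = 0" by (simp add: z_def algebra_simps)
    then show "s = t" using w by auto
  qed
  then have "infinite ((\<lambda>s (i::'d). z s) ` {0<..<\<epsilon>})"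
    using \<epsilon> by (simp add: finite_image_iff infinite_Ioo)
  then obtain s where s: "0 < s" "s < \<epsilon>" "(\<lambda>i. z s) \<notin> F"
    using finite_subset[of "(\<lambda>s (i::'d). z s) ` {0<..<\<epsilon>}" F] by (force simp: F_def)
  have "(\<Sum>k<M. norm (z 0 k - z s k)) \<le> s" for M
    using sum_z[of 0 "1 + s" M] s by (simp add: z_def)
  then have "d (z 0) (z s) \<le> s" using s by (intro dist_le_l1 z_S) auto
  then have "(\<lambda>i. z s) \<in> W - F" using s z_S by (auto simp: W_def)
  moreover have "openin ?Y (W - F)"
  proof (rule openin_diff)
    show "openin ?Y W" unfolding W_def by (intro product_topology_basis) auto
    show "closedin ?Y F"
      by (rule closedin_Hausdorff_finite)
        (auto simp: F_def Hausdorff_space_product_topology Hausdorff_space_mtopology)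
  qed
  ultimately have "range (\<lambda>n. (shift_product l ^^ n) x) \<inter> (W - F) \<noteq> {}"
    using hyp unfolding hypercyclic_vector_def dense_intersects_open by blast
  then obtain n where n: "(shift_product l ^^ n) x \<in> W" "(shift_product l ^^ n) x \<notin> F" by auto
  then have "(shift_product l ^^ n) x \<in> topspace ?Y"
    by (auto simp: W_def topspace_product simp del: topspace_product_topology)
  then have "N \<le> n" using n(2) by (auto simp: F_def not_less[symmetric])
  have near: "norm (exp (l $ i * real n) *\<^sub>R x i (n + k) - z 0 k) < \<epsilon>" for i k
  proof -
    have "(shift_product l ^^ n) x i \<in> mball (z 0) \<epsilon>" using n(1) by (auto simp: W_def)
    then have "norm ((shift_product l ^^ n) x i k - z 0 k) < \<epsilon>"
      using norm_coord_le[of "(shift_product l ^^ n) x i" "z 0" k] by (auto simp: commute)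
    then show ?thesis by (simp add: shift_product_funpow)
  qed
  show ?thesis
  proof (intro exI[of _ n] conjI allI impI \<open>N \<le> n\<close>)
    fix i j
    show "norm (exp (l $ i * real n) *\<^sub>R x i (n + m) - w) < \<epsilon>" using near[of i m] by (simp add: z_def)
    show "norm (exp (l $ i * real n) *\<^sub>R x i (n + j)) < \<epsilon>" if "j \<noteq> m"
      using near[of i j] that by (simp add: z_def)
  qed
qed

text \<open>A point of a basic open set is truncated coordinatewise at a cost below
  \<open>r i / 2\<close>, and the orbit comes within \<open>e \<le> r i / 2\<close> of the
  truncation. The iterates stay in \<open>S\<close> because their l1 norms are at most
  \<open>exp (l $ i * n) * c\<close>.\<close>

lemma hypercyclic_of_l1_approximation:
  fixes x :: "'d::finite \<Rightarrow> nat \<Rightarrow> 'a"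
  assumes x: "\<And>i M. (\<Sum>k<M. norm (x i k)) \<le> c"
    and near: "\<And>v m e. (\<And>i k. m \<le> k \<Longrightarrow> v i k = 0) \<Longrightarrow> 0 < e \<Longrightarrow>
      \<exists>n. \<forall>i M. (\<Sum>k<M. norm (exp (l $ i * real n) *\<^sub>R x i (n + k) - v i k)) \<le> e"
  shows "hypercyclic_vector (product_topology (\<lambda>i::'d. mtopology) UNIV) (shift_product l) x"
  unfolding hypercyclic_vector_def dense_intersects_open
proof (intro conjI allI impI)
  let ?Y = "product_topology (\<lambda>i::'d. mtopology) UNIV"
  show "x \<in> topspace ?Y"
    unfolding topspace_product using mem_of_l1[OF x] by blast
  fix U assume U: "openin ?Y U \<and> U \<noteq> {}"
  then obtain z where "z \<in> U" by blast
  then obtain W where W: "z \<in> PiE UNIV W" "\<And>i. openin mtopology (W i)" "PiE UNIV W \<subseteq> U"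
    using product_topology_open_contains_basis[of "\<lambda>i::'d. mtopology" UNIV U z] U by auto
  have "\<exists>r>0. mball (z i) r \<subseteq> W i" for i
    using W(1) W(2)[of i] unfolding openin_mtopology by auto
  then obtain r where r: "\<And>i. 0 < r i" "\<And>i. mball (z i) (r i) \<subseteq> W i" by metis
  have z_S: "z i \<in> S" for i using W(1) openin_subset[OF W(2), of i] by auto
  have "\<exists>m. d (z i) (\<lambda>k. if k < m then z i k else 0) < r i / 2" for i
    by (intro truncation_dense z_S) (simp add: r(1))
  then obtain m where m: "\<And>i. d (z i) (\<lambda>k. if k < m i then z i k else 0) < r i / 2" by metis
  define v where "v i = (\<lambda>k. if k < m i then z i k else 0)" for i
  have v0: "v i k = 0" if "Max (range m) \<le> k" for i k
  proof -
    have "m i \<le> Max (range m)" by (rule Max_ge) auto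
    then have "m i \<le> k" using that by (rule order_trans)
    then show ?thesis by (simp add: v_def)
  qed
  define e where "e = Min (range r) / 2"
  have e_pos: "0 < e" using r(1) by (simp add: e_def)
  have e_le: "e \<le> r i / 2" for i
  proof -
    have "Min (range r) \<le> r i" by (rule Min_le) auto
    then show ?thesis by (simp add: e_def)
  qed
  obtain V where "\<And>i M. (\<Sum>k<M. norm (v i k)) \<le> V"
    using finite_support_sum_norm_bound[of "Max (range m)" v, OF v0] by blast
  then have v_S: "v i \<in> S" for i by (rule mem_of_l1)
  obtain n where n: "\<And>i M. (\<Sum>k<M. norm (exp (l $ i * real n) *\<^sub>R x i (n + k) - v i k)) \<le> e"
    using near[of "Max (range m)" v e, OF v0 e_pos] by blast
  define y where "y = (shift_product l ^^ n) x"
  have y: "y i k = exp (l $ i * real n) *\<^sub>R x i (n + k)" for i k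
    by (simp add: y_def shift_product_funpow)
  have y_S: "y i \<in> S" for i
  proof (rule mem_of_l1)
    fix M
    have "(\<Sum>k<M. norm (y i k)) = exp (l $ i * real n) * (\<Sum>k<M. norm (x i (n + k)))"
      by (simp add: y sum_distrib_left)
    also have "\<dots> \<le> exp (l $ i * real n) * c"
      using sum_shift_le[of "\<lambda>k. norm (x i k)" n M] x[of i "n + M"] by (intro mult_left_mono) auto
    finally show "(\<Sum>k<M. norm (y i k)) \<le> exp (l $ i * real n) * c" .
  qed
  have "y i \<in> W i" for i
  proof -
    have "d (y i) (v i) \<le> e" using n[of i] e_pos by (intro dist_le_l1 y_S v_S) (auto simp: y)
    then have "d (z i) (y i) < r i"
      using triangle[OF z_S v_S y_S, of i i i] m[of i] e_le[of i] by (simp add: v_def commute)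
    then show ?thesis using r(2)[of i] z_S y_S by auto
  qed
  then have "y \<in> U" using W(3) by auto
  then show "range (\<lambda>n. (shift_product l ^^ n) x) \<inter> U \<noteq> {}" by (auto simp: y_def)
qed

end

section \<open>The equivalence for all these spaces at once\<close>

lemma common_hypercyclic_iff_gap_covering:
  fixes S :: "(nat \<Rightarrow> 'a::{real_normed_field, second_countable_topology}) set"
    and \<Lambda> :: "(real ^ 'd::finite) set"
  assumes X: "sequence_metric S d"
    and \<Lambda>: "\<Lambda> \<subseteq> {l. \<forall>i. 0 < l $ i}" "sigma_compact \<Lambda>"
  shows "has_common_hypercyclic_vector
      (product_topology (\<lambda>i::'d. Metric_space.mtopology S d) UNIV) (shift_product ` \<Lambda>)
    \<longleftrightarrow> (\<forall>\<tau>>0. \<forall>N\<ge>1. \<forall>K. compact K \<and> K \<subseteq> \<Lambda> \<longrightarrow> gap_covering \<tau> N K)"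
proof -
  interpret sequence_metric S d by (rule X)
  show ?thesis
  proof
    assume "has_common_hypercyclic_vector (product_topology (\<lambda>i::'d. mtopology) UNIV) (shift_product ` \<Lambda>)"
    then obtain x where x: "\<And>l. l \<in> \<Lambda> \<Longrightarrow>
        hypercyclic_vector (product_topology (\<lambda>i::'d. mtopology) UNIV) (shift_product l) x"
      unfolding has_common_hypercyclic_vector_def by blast
    show "\<forall>\<tau>>0. \<forall>N\<ge>1. \<forall>K. compact K \<and> K \<subseteq> \<Lambda> \<longrightarrow> gap_covering \<tau> N K"
    proof (intro allI impI)
      fix \<tau> :: real and N :: nat and K :: "(real ^ 'd) set" assume "0 < \<tau>" "1 \<le> N" and K: "compact K \<and> K \<subseteq> \<Lambda>"
      show "gap_covering \<tau> N K"
      proof (rule gap_covering_of_visits[OF _ _ norm_one \<open>0 < \<tau>\<close> \<open>1 \<le> N\<close>])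
        show "compact K" "K \<subseteq> {l. \<forall>i. 0 < l $ i}" using K \<Lambda>(1) by blast+
        show "\<exists>n\<ge>N. \<forall>i. norm (exp (l $ i * real n) *\<^sub>R x i (n + N) - 1) < \<epsilon> \<and>
            (\<forall>j. j \<noteq> N \<longrightarrow> norm (exp (l $ i * real n) *\<^sub>R x i (n + j)) < \<epsilon>)"
          if "0 < \<epsilon>" "l \<in> K" for \<epsilon> l
          using hypercyclic_visits[OF x norm_one that(1)] that(2) K by blast
      qed
    qed
  next
    assume cov: "\<forall>\<tau>>0. \<forall>N\<ge>1. \<forall>K. compact K \<and> K \<subseteq> \<Lambda> \<longrightarrow> gap_covering \<tau> N K"
    obtain K where K: "\<And>j::nat. compact (K j)" "\<Lambda> = (\<Union>j. K j)"
      using \<Lambda>(2) unfolding sigma_compact_def by blast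
    have "\<exists>(x :: 'd \<Rightarrow> nat \<Rightarrow> 'a) c. (\<forall>i M. (\<Sum>k<M. norm (x i k)) \<le> c) \<and>
      (\<forall>j. \<forall>l\<in>K j. \<forall>v m e. (\<forall>i k. m \<le> k \<longrightarrow> v i k = 0) \<and> 0 < e \<longrightarrow>
        (\<exists>n. \<forall>i M. (\<Sum>k<M. norm (exp (l $ i * real n) *\<^sub>R x i (n + k) - v i k)) \<le> e))"
    proof (rule l1_common_approximation[OF K(1)])
      show "K j \<subseteq> {l. \<forall>i. 0 < l $ i}" for j using \<Lambda>(1) K(2) by blast
      show "gap_covering \<tau> N (K j)" if "0 < \<tau>" "1 \<le> N" for j and \<tau> :: real and N :: nat
        using cov that K by blast
    qed
    then obtain x :: "'d \<Rightarrow> nat \<Rightarrow> 'a" and c where x: "\<And>i M. (\<Sum>k<M. norm (x i k)) \<le> c"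
      and near: "\<forall>j. \<forall>l\<in>K j. \<forall>v m e. (\<forall>i k. m \<le> k \<longrightarrow> v i k = 0) \<and> 0 < e \<longrightarrow>
        (\<exists>n. \<forall>i M. (\<Sum>k<M. norm (exp (l $ i * real n) *\<^sub>R x i (n + k) - v i k)) \<le> e)"
      by blast
    have "hypercyclic_vector (product_topology (\<lambda>i::'d. mtopology) UNIV) (shift_product l) x"
      if l: "l \<in> \<Lambda>" for l
    proof (rule hypercyclic_of_l1_approximation[OF x])
      fix v :: "'d \<Rightarrow> nat \<Rightarrow> 'a" and m :: nat and e :: real
      assume "\<And>i k. m \<le> k \<Longrightarrow> v i k = 0" "0 < e"
      moreover obtain j where "l \<in> K j" using l K(2) by blast
      ultimately show "\<exists>n. \<forall>i M. (\<Sum>k<M. norm (exp (l $ i * real n) *\<^sub>R x i (n + k) - v i k)) \<le> e"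
        using near[rule_format, of l j m v e] by blast
    qed
    moreover have "x \<in> topspace (product_topology (\<lambda>i::'d. mtopology) UNIV)"
      unfolding topspace_product using mem_of_l1[OF x] by blast
    ultimately show "has_common_hypercyclic_vector
        (product_topology (\<lambda>i::'d. mtopology) UNIV) (shift_product ` \<Lambda>)"
      unfolding has_common_hypercyclic_vector_def by blast
  qed
qed

theorem theorem2p2:
  fixes \<Lambda> :: "(real ^ 'd::finite) set"
    and X :: "(nat \<Rightarrow> 'a::{real_normed_field, euclidean_space}) topology"
  assumes "\<Lambda> \<subseteq> {l. \<forall>i. 0 < l $ i}"
    and "sigma_compact \<Lambda>"
    and "(\<exists>p\<ge>1. X = lp_space p) \<or> X = c0_space"
  shows "has_common_hypercyclic_vector (product_topology (\<lambda>i::'d. X) UNIV) (shift_product ` \<Lambda>)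
    \<longleftrightarrow>
    (\<forall>\<tau>>0. \<forall>N\<ge>1. \<forall>K. compact K \<and> K \<subseteq> \<Lambda> \<longrightarrow>
      (\<exists>(q::nat) (n :: nat \<Rightarrow> nat) (l :: nat \<Rightarrow> real ^ 'd).
        q \<ge> 1 \<and> n 1 \<ge> N \<and> (\<forall>k\<in>{1..<q}. n (k + 1) \<ge> n k + N) \<and>
        (\<forall>k\<in>{1..q}. \<forall>i. 0 < l k $ i) \<and>
        K \<subseteq> (\<Union>k\<in>{1..q}. {x. \<forall>i. x $ i \<in> {l k $ i - \<tau> / real (n k) .. l k $ i}}) \<and>
        (\<forall>k\<in>{1..<q}. \<forall>i.
          l (k + 1) $ i * real (n (k + 1)) - l k $ i * real (n k) \<ge> real N)))"
proof -
  obtain S d where "sequence_metric S d" "X = Metric_space.mtopology S d"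
    using assms(3) sequence_metric_lp sequence_metric_c0 unfolding lp_space_def c0_space_def by blast
  then show ?thesis
    using common_hypercyclic_iff_gap_covering[OF _ assms(1,2)]
    unfolding gap_covering_def[symmetric] by blast
qed

end
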